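(* For any statistic $f$ of degree $N$ there exists a shifted Bell polynomial $R$ such that for all $n\ge 1$ $$M(f;n):=\sum_{\lambda\in\Pi(n)}f(\lambda)=R(n).$$ Moreover: (1) the upper shift index of $R$ is at most $N$ and the lower shift index is bounded below by $-k$, where $k$ is the length of the pattern associated to $f$; (2) the degree of the polynomial coefficient of $B_{n+N-j}$ in $R$ is bounded by $j$ for $j\le N$ and by $j-1$ for $j>N$.
   Context: For $n\ge 0$, $\Pi(n)$ is the set of set partitions of $[n]=\{1,\dots,n\}$ and $B_n=|\Pi(n)|$ is the $n$th Bell number. For $\lambda\in\Pi(n)$ write $i\sim_\lambda j$ if $i,j$ lie in the same block. Let $\mathbf{First}(\lambda)$ be the set of elements that are smallest in their block, $\mathbf{Last}(\lambda)$ the set of elements that are largest in their block, and $\mathbf{Arc}(\lambda)$ the set of pairs $(i,j)$ with $i<j$, $i\sim_\lambda j$, and $j$ the smallest element of the block of $i$ greater than $i$. A pattern of length $k$ is $\underline{P}=(P,\mathbf{F},\mathbf{L},\mathbf{A},\mathbf{C})$ with $P$ a set partition of $[k]$, $\mathbf{F},\mathbf{L}\subseteq[k]$, $\mathbf{A},\mathbf{C}\subseteq[k]\times[k]$. An occurrence of $\underline P$ in $\lambda\in\Pi(n)$ is $s=(x_1,\dots,x_k)\in[n]^k$ with: (1) $x_1<\dots<x_k$; (2) $x_i\sim_\lambda x_j$ iff $i\sim_P j$; (3) $x_i\in\mathbf{First}(\lambda)$ if $i\in\mathbf F$; (4) $x_i\in\mathbf{Last}(\lambda)$ if $i\in\mathbf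 L$; (5) $(x_i,x_j)\in\mathbf{Arc}(\lambda)$ if $(i,j)\in\mathbf A$; (6) $|x_i-x_j|=1$ if $(i,j)\in\mathbf C$. A simple statistic is given by a pattern $\underline P$ of length $k$ and $Q\in\mathbb{Z}[y_1,\dots,y_k,m]$: $f_{\underline P,Q}(\lambda)=\sum_s Q(x_1,\dots,x_k,n)$ over occurrences $s$ of $\underline P$ in $\lambda\in\Pi(n)$; its degree is $k+\deg Q$. A statistic is a finite $\mathbb{Q}$-linear combination of simple statistics; its degree is the minimum over such representations of the maximum degree of an appearing simple statistic. A shifted Bell polynomial is a function $R:\mathbb{N}\to\mathbb{Q}$ of the form $R(n)=\sum_{I\le j\le K}Q_j(n)B_{n+j}$ with $I,K\in\mathbb{Z}$ and $Q_j\in\mathbb{Q}[x]$; $K$ is its upper shift index and $I$ its lower shift index.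
   Formalization: The identity is asserted for those n ≥ 1 that are at least the number of distinct conditions |x_i − x_j| = 1 in each pattern of the chosen representation of f (for smaller n it can fail); k is the maximal pattern length in that representation, and B_m = 0 for m < 0. *)

theory Defs
  imports
    Complex_Main
    "HOL-Library.FuncSet"
    "HOL-Library.Disjoint_Sets"
    "HOL-Library.Poly_Mapping"
    "HOL-Computational_Algebra.Polynomial"
begin

definition set_partitions :: "nat \<Rightarrow> nat set set set" where
  "set_partitions n = {\<pi>. partition_on {1..n} \<pi>}"

(* Shifted indices can be negative; as there are no partitions then, the value is 0. *)
definition bell :: "int \<Rightarrow> nat" where
  "bell m = (if m < 0 then 0 else card (set_partitions (nat m)))"

definition same_block :: "nat set set \<Rightarrow> nat \<Rightarrow> nat \<Rightarrow> bool" where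
  "same_block \<pi> i j \<longleftrightarrow> (\<exists>B\<in>\<pi>. i \<in> B \<and> j \<in> B)"

definition First :: "nat set set \<Rightarrow> nat set" where
  "First \<pi> = {i. \<exists>B\<in>\<pi>. i \<in> B \<and> (\<forall>j\<in>B. i \<le> j)}"

definition Last :: "nat set set \<Rightarrow> nat set" where
  "Last \<pi> = {i. \<exists>B\<in>\<pi>. i \<in> B \<and> (\<forall>j\<in>B. j \<le> i)}"

definition Arc :: "nat set set \<Rightarrow> (nat \<times> nat) set" where
  "Arc \<pi> = {(i, j). i < j \<and> (\<exists>B\<in>\<pi>. i \<in> B \<and> j \<in> B \<and> (\<forall>l\<in>B. i < l \<longrightarrow> j \<le> l))}"

record pattern =
  pat_length :: nat
  pat_partition :: "nat set set"
  pat_first :: "nat set"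
  pat_last :: "nat set"
  pat_arcs :: "(nat \<times> nat) set"
  pat_consec :: "(nat \<times> nat) set"

definition is_pattern :: "pattern \<Rightarrow> bool" where
  "is_pattern p \<longleftrightarrow>
     pat_partition p \<in> set_partitions (pat_length p) \<and>
     pat_first p \<subseteq> {1..pat_length p} \<and>
     pat_last p \<subseteq> {1..pat_length p} \<and>
     pat_arcs p \<subseteq> {1..pat_length p} \<times> {1..pat_length p} \<and>
     pat_consec p \<subseteq> {1..pat_length p} \<times> {1..pat_length p}"

(* Number of distinct conditions |x_i - x_j| = 1; (i,j) and (j,i) impose the same one.
   Below this n the moment can differ from the shifted Bell polynomial: counting triples
   i, i+1, i+2 in distinct blocks with i smallest in its block gives
   B_{n+1} - 4 B_n + 3 B_{n-1} for n >= 2, which is 1 at n = 1, where the moment is 0. *)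
definition num_consec :: "pattern \<Rightarrow> nat" where
  "num_consec p = card ((\<lambda>(i, j). {i, j}) ` pat_consec p)"

definition occurrences :: "pattern \<Rightarrow> nat \<Rightarrow> nat set set \<Rightarrow> (nat \<Rightarrow> nat) set" where
  "occurrences p n \<pi> =
     {x \<in> {1..pat_length p} \<rightarrow>\<^sub>E {1..n}.
        strict_mono_on {1..pat_length p} x \<and>
        (\<forall>i\<in>{1..pat_length p}. \<forall>j\<in>{1..pat_length p}.
           same_block \<pi> (x i) (x j) \<longleftrightarrow> same_block (pat_partition p) i j) \<and>
        (\<forall>i\<in>pat_first p. x i \<in> First \<pi>) \<and>
        (\<forall>i\<in>pat_last p. x i \<in> Last \<pi>) \<and>
        (\<forall>(i, j)\<in>pat_arcs p. (x i, x j) \<in> Arc \<pi>) \<and>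
        (\<forall>(i, j)\<in>pat_consec p. \<bar>int (x i) - int (x j)\<bar> = 1)}"

(* Integer polynomials in countably many variables: monomials are finitely supported
   exponent functions. In a simple statistic of length k, variable 0 is the extra variable m
   (evaluated at n), and variable i with 1 <= i <= k is y_i. *)
type_synonym int_mpoly = "(nat \<Rightarrow>\<^sub>0 nat) \<Rightarrow>\<^sub>0 int"

definition mpoly_eval :: "(nat \<Rightarrow> int) \<Rightarrow> int_mpoly \<Rightarrow> int" where
  "mpoly_eval v Q =
     (\<Sum>e\<in>Poly_Mapping.keys Q. Poly_Mapping.lookup Q e *
        (\<Prod>i\<in>Poly_Mapping.keys e. v i ^ Poly_Mapping.lookup e i))"

definition mpoly_degree :: "int_mpoly \<Rightarrow> nat" where
  "mpoly_degree Q =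
     Max (insert 0 ((\<lambda>e. \<Sum>i\<in>Poly_Mapping.keys e. Poly_Mapping.lookup e i) ` Poly_Mapping.keys Q))"

definition mpoly_vars :: "int_mpoly \<Rightarrow> nat set" where
  "mpoly_vars Q = (\<Union>e\<in>Poly_Mapping.keys Q. Poly_Mapping.keys e)"

(* Statistics take n as an explicit argument; only the values at partitions of {1..n} matter. *)
type_synonym statistic = "nat \<Rightarrow> nat set set \<Rightarrow> rat"

definition simple_stat :: "pattern \<Rightarrow> int_mpoly \<Rightarrow> statistic" where
  "simple_stat p Q n \<pi> =
     of_int (\<Sum>x\<in>occurrences p n \<pi>. mpoly_eval (\<lambda>i. if i = 0 then int n else int (x i)) Q)"

type_synonym stat_rep = "(rat \<times> pattern \<times> int_mpoly) list"

definition represents :: "stat_rep \<Rightarrow> statistic \<Rightarrow> bool" where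
  "represents r f \<longleftrightarrow>
     (\<forall>(c, p, Q)\<in>set r. is_pattern p \<and> mpoly_vars Q \<subseteq> {0..pat_length p}) \<and>
     (\<forall>n. \<forall>\<pi>\<in>set_partitions n. f n \<pi> = (\<Sum>(c, p, Q)\<leftarrow>r. c * simple_stat p Q n \<pi>))"

definition rep_degree :: "stat_rep \<Rightarrow> nat" where
  "rep_degree r = Max (insert 0 ((\<lambda>(c, p, Q). pat_length p + mpoly_degree Q) ` set r))"

definition rep_length :: "stat_rep \<Rightarrow> nat" where
  "rep_length r = Max (insert 0 ((\<lambda>(c, p, Q). pat_length p) ` set r))"

definition stat_degree :: "statistic \<Rightarrow> nat" where
  "stat_degree f = (LEAST d. \<exists>r. represents r f \<and> rep_degree r = d)"

definition moment :: "statistic \<Rightarrow> nat \<Rightarrow> rat" where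
  "moment f n = (\<Sum>\<pi>\<in>set_partitions n. f n \<pi>)"

definition shifted_bell_poly :: "int \<Rightarrow> int \<Rightarrow> (int \<Rightarrow> rat poly) \<Rightarrow> (nat \<Rightarrow> rat) \<Rightarrow> bool" where
  "shifted_bell_poly I K q R \<longleftrightarrow>
     I \<le> K \<and> (\<forall>n. R n = (\<Sum>j=I..K. poly (q j) (of_nat n) * of_nat (bell (int n + j))))"

end

theory Submission
  imports Defs "HOL-Computational_Algebra.Primes"
begin

text \<open>
  For a fixed increasing tuple \<open>x\<close> the partitions in which \<open>x\<close> is an occurrence are counted
  umbrally. Let \<open>L\<close> be the linear functional on polynomials with \<open>L(X\<^sup>m) = B\<^sub>m\<close>. An unmarked element
  in the gap \<open>g\<close> between consecutive marked positions either joins one of the \<open>a\<^sub>g\<close> marked blocks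
  that tolerate it or belongs to the rest, so the count is \<open>L(\<Prod>\<^sub>g (X + a\<^sub>g)\<^bsup>d(g)\<^esup>)\<close>, \<open>d(g)\<close> being
  the size of gap \<open>g\<close>.

  Summing this against a monomial in \<open>x\<close>, one position at a time, is an iterated convolution. As
  the \<open>X + a\<^sub>g\<close> differ by constants, partial fractions stay polynomial in \<open>X\<close>: the sum is a
  combination of terms \<open>(T choose r) (X + a)\<^bsup>T - r + i\<^esup>\<close> with \<open>T = n - c\<close>, where \<open>c\<close> is the number of
  consecutivity conditions. Since \<open>L((X + a)\<^sup>m) = L(X (X - 1) \<dots> (X - a + 1) X\<^sup>m)\<close>, each term becomes
  a shifted Bell polynomial, and the bounds on \<open>i\<close> and \<open>r\<close> give the bounds on shifts and degrees.

  The degree \<open>N\<close> and the length \<open>k\<close> may come from different representations of the statistic, so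
  it is also needed that the coefficients of a shifted Bell polynomial are unique. If
  \<open>\<Sum>\<^sub>j Q\<^sub>j(n) B\<^bsub>n+j\<^esub> = 0\<close> for all large \<open>n\<close>, then Touchard's congruence
  \<open>B\<^bsub>n+p\<^esub> \<equiv> B\<^sub>n + B\<^bsub>n+1\<^esub> (mod p)\<close>, used for every prime \<open>p\<close>, decouples the two occurrences of \<open>n\<close>:
  \<open>\<Sum>\<^sub>j Q\<^sub>j(n) B\<^bsub>n+i+j\<^esub> = 0\<close> for all \<open>i\<close>. That is a linear recurrence with constant coefficients, which
  the Bell numbers outgrow.
\<close>

section \<open>The Bell functional and extensions of marked blocks\<close>

text \<open>The coefficient ring is left open because the functional serves twice: over
  \<open>rat\<close> it counts partitions, over \<open>int\<close> it carries congruences.\<close>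

definition bell_eval :: "'a::comm_ring_1 poly \<Rightarrow> 'a" where
  "bell_eval f = (\<Sum>i\<le>degree f. coeff f i * of_nat (bell (int i)))"

lemma bell_eval_eq:
  assumes "degree f \<le> m"
  shows "bell_eval f = (\<Sum>i\<le>m. coeff f i * of_nat (bell (int i)))"
  unfolding bell_eval_def
  by (rule sum.mono_neutral_left) (use assms in \<open>auto simp: coeff_eq_0\<close>)

lemma bell_eval_add: "bell_eval (f + g) = bell_eval f + bell_eval g"
proof -
  define m where "m = max (degree f) (degree g)"
  have "degree f \<le> m" "degree g \<le> m" "degree (f + g) \<le> m"
    by (auto simp: m_def degree_add_le_max)
  then show ?thesis
    by (simp add: bell_eval_eq[where m = m] algebra_simps sum.distrib)
qed

lemma bell_eval_smult: "bell_eval (smult c f) = c * bell_eval f"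
  by (subst bell_eval_eq[where m = "degree f"])
     (simp_all add: degree_smult_le bell_eval_def sum_distrib_left mult.assoc)

lemma bell_eval_0 [simp]: "bell_eval 0 = 0"
  by (simp add: bell_eval_def)

lemma bell_eval_diff: "bell_eval (f - g) = bell_eval f - bell_eval g"
  using bell_eval_add[of "f - g" g] by simp

lemma bell_eval_sum: "bell_eval (\<Sum>i\<in>A. f i) = (\<Sum>i\<in>A. bell_eval (f i))"
  by (induction A rule: infinite_finite_induct) (simp_all add: bell_eval_add)

lemma bell_eval_monom: "bell_eval (monom c n) = c * of_nat (bell (int n))"
proof -
  have "bell_eval (monom c n) = (\<Sum>i\<le>n. (if i = n then c * of_nat (bell (int n)) else 0))"
    unfolding bell_eval_eq[OF degree_monom_le] by (intro sum.cong) auto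
  then show ?thesis by simp
qed

lemma bell_eval_X_power: "bell_eval ([:0, 1:] ^ n) = of_nat (bell (int n))"
  using bell_eval_monom[of 1 n] by (simp add: monom_altdef)

section \<open>Counting the partitions that extend marked blocks\<close>

lemma card_partitions_eq_bell:
  assumes "finite A"
  shows "card {P. partition_on A P} = bell (int (card A))"
proof -
  obtain h where h: "bij_betw h {1..card A} A"
    using ex_bij_betw_nat_finite_1[OF assms] by blast
  \<comment> \<open>Applied to \<open>h\<close> and to its inverse, this makes the two induced maps
    on partitions mutually inverse.\<close>
  have transport: "partition_on B ((`) g ` P) \<and> (`) g' ` (`) g ` P = P"
    if "bij_betw g A' B" "\<forall>a\<in>A'. g' (g a) = a" "partition_on A' P" for g g' A' B P
  proof -
    from that have inj: "inj_on g A'" and B: "B = g ` A'" by (auto simp: bij_betw_def)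
    have sub: "S \<subseteq> A'" if "S \<in> P" for S
      using \<open>partition_on A' P\<close> that by (auto simp: partition_on_def)
    have "partition_on B ((`) g ` P - {{}})"
      unfolding B by (rule partition_on_inj_image[OF that(3) inj])
    moreover have "{} \<notin> (`) g ` P" using that(3) by (auto simp: partition_on_def)
    moreover have "g' ` g ` S = S" if "S \<in> P" for S
    proof -
      have "g' ` g ` S = (\<lambda>a. g' (g a)) ` S" by (simp add: image_image)
      also have "\<dots> = (\<lambda>a. a) ` S" by (rule image_cong) (use sub[OF that] \<open>\<forall>a\<in>A'. g' (g a) = a\<close> in auto)
      finally show ?thesis by simp
    qed
    ultimately show ?thesis by (auto simp: image_image)
  qed
  define h' where "h' = the_inv_into {1..card A} h"
  have h': "bij_betw h' A {1..card A}" "\<forall>a\<in>{1..card A}. h' (h a) = a" "\<forall>a\<in>A. h (h' a) = a"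
    unfolding h'_def using bij_betw_the_inv_into[OF h] h
    by (auto simp: bij_betw_def intro: the_inv_into_f_f f_the_inv_into_f)
  have "bij_betw ((`) ((`) h)) (set_partitions (card A)) {P. partition_on A P}"
    by (rule bij_betw_byWitness[where f' = "(`) ((`) h')"])
       (use transport[OF h h'(2)] transport[OF h'(1) h'(3)] in \<open>auto simp: set_partitions_def\<close>)
  then show ?thesis by (simp add: bell_def bij_betw_same_card)
qed

text \<open>\<open>P\<close> holds the marked blocks, \<open>U\<close> the unmarked elements and
  \<open>A b\<close> those that \<open>b\<close> tolerates. When \<open>U\<close> avoids
  \<open>\<Union>P\<close>, no \<open>V\<close> can swallow another marked block; what the marked
  blocks leave of \<open>U\<close> may form any blocks.\<close>

definition block_extensions :: "'a set set \<Rightarrow> 'a set \<Rightarrow> ('a set \<Rightarrow> 'a set) \<Rightarrow> 'a set set set" where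
  "block_extensions P U A =
     {\<pi>. partition_on (\<Union>P \<union> U) \<pi> \<and> (\<forall>b\<in>P. \<exists>V. V \<subseteq> U \<inter> A b \<and> b \<union> V \<in> \<pi>)}"

lemma finite_block_extensions:
  assumes "finite (\<Union>P \<union> U)"
  shows "finite (block_extensions P U A)"
  by (rule finite_subset[OF _ finitely_many_partition_on[OF assms]])
     (auto simp: block_extensions_def)

lemma partition_on_same:
  assumes "partition_on A P" "S \<in> P" "T \<in> P" "x \<in> S" "x \<in> T"
  shows "S = T"
  using assms by (auto simp: partition_on_def pairwise_def disjnt_iff)

text \<open>The block through \<open>b\<close> determines \<open>V\<close>, since \<open>b\<close>
  is nonempty and meets neither \<open>U\<close> nor the other marked blocks. Removing that block
  leaves an extension of \<open>P\<close> by the elements it did not take.\<close>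

lemma block_extensions_insert:
  assumes P: "disjoint (insert b P)" "b \<notin> P" "b \<noteq> {}" "U \<inter> \<Union>(insert b P) = {}"
  shows "bij_betw (\<lambda>(V, \<pi>). insert (b \<union> V) \<pi>)
           (SIGMA V:Pow (U \<inter> A b). block_extensions P (U - V) A)
           (block_extensions (insert b P) U A)"
proof -
  have bP: "b \<inter> \<Union>P = {}" using P(1,2) by (auto simp: pairwise_def disjnt_iff)
  have bU: "b \<inter> U = {}" and UP: "U \<inter> \<Union>P = {}" using P(4) by auto
  show ?thesis
    unfolding bij_betw_def
  proof (intro conjI)
    show "inj_on (\<lambda>(V, \<pi>). insert (b \<union> V) \<pi>) (SIGMA V:Pow (U \<inter> A b). block_extensions P (U - V) A)"
    proof (rule inj_onI, clarify)
      fix V \<pi> W \<rho>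
      assume V: "V \<subseteq> U \<inter> A b" "\<pi> \<in> block_extensions P (U - V) A"
        and W: "W \<subseteq> U \<inter> A b" "\<rho> \<in> block_extensions P (U - W) A"
        and eq: "insert (b \<union> V) \<pi> = insert (b \<union> W) \<rho>"
      have ndp: "S \<inter> b = {}" if "S \<in> \<pi>" for S
      proof -
        have "S \<subseteq> \<Union>P \<union> U" using V that unfolding block_extensions_def partition_on_def by blast
        then show ?thesis using bP bU by blast
      qed
      have ndr: "S \<inter> b = {}" if "S \<in> \<rho>" for S
      proof -
        have "S \<subseteq> \<Union>P \<union> U" using W that unfolding block_extensions_def partition_on_def by blast
        then show ?thesis using bP bU by blast
      qed
      have "b \<union> V \<in> insert (b \<union> W) \<rho>" using eq by auto
      then have "b \<union> V = b \<union> W" using ndr P(3) by blast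
      then have "V = W" using V W bU by auto
      moreover have "b \<union> V \<notin> \<pi>" "b \<union> W \<notin> \<rho>" using ndp ndr P(3) by blast+
      ultimately show "V = W \<and> \<pi> = \<rho>" using eq by (metis insert_ident)
    qed
  next
    show "(\<lambda>(V, \<pi>). insert (b \<union> V) \<pi>) ` (SIGMA V:Pow (U \<inter> A b). block_extensions P (U - V) A)
          = block_extensions (insert b P) U A"
    proof (intro set_eqI iffI)
      fix \<sigma> assume "\<sigma> \<in> (\<lambda>(V, \<pi>). insert (b \<union> V) \<pi>) ` (SIGMA V:Pow (U \<inter> A b). block_extensions P (U - V) A)"
      then obtain V \<pi> where V: "V \<subseteq> U \<inter> A b" and pi: "partition_on (\<Union>P \<union> (U - V)) \<pi>"
        and ext: "\<And>c. c \<in> P \<Longrightarrow> \<exists>W. W \<subseteq> (U - V) \<inter> A c \<and> c \<union> W \<in> \<pi>"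
        and \<sigma>: "\<sigma> = insert (b \<union> V) \<pi>"
        unfolding block_extensions_def by blast
      have dj: "disjnt (b \<union> V) (\<Union>\<pi>)"
        using pi bP bU UP V by (auto simp: partition_on_def disjnt_iff)
      have "\<Union>(insert b P) \<union> U - (b \<union> V) = \<Union>P \<union> (U - V)" using bP bU UP V by auto
      then have "partition_on (\<Union>(insert b P) \<union> U) \<sigma>"
        unfolding \<sigma> using partition_on_insert[OF dj] pi V P(3) by auto
      moreover have "\<exists>W. W \<subseteq> U \<inter> A c \<and> c \<union> W \<in> \<sigma>" if "c \<in> insert b P" for c
      proof (cases "c = b")
        case True
        then show ?thesis using V \<sigma> by blast
      next
        case False
        then have "c \<in> P" using that by simp
        from ext[OF this] obtain W where "W \<subseteq> (U - V) \<inter> A c" "c \<union> W \<in> \<pi>" by blast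
        then show ?thesis using \<sigma> by blast
      qed
      ultimately show "\<sigma> \<in> block_extensions (insert b P) U A"
        unfolding block_extensions_def by blast
    next
      fix \<sigma> assume "\<sigma> \<in> block_extensions (insert b P) U A"
      then have \<sigma>: "partition_on (\<Union>(insert b P) \<union> U) \<sigma>"
        and ext: "\<forall>c\<in>insert b P. \<exists>W. W \<subseteq> U \<inter> A c \<and> c \<union> W \<in> \<sigma>"
        unfolding block_extensions_def by simp_all
      obtain V where V: "V \<subseteq> U \<inter> A b" "b \<union> V \<in> \<sigma>" using bspec[OF ext, of b] by auto
      define \<pi> where "\<pi> = \<sigma> - {b \<union> V}"
      have ins: "\<sigma> = insert (b \<union> V) \<pi>" using V by (auto simp: \<pi>_def)
      have other: "S \<inter> (b \<union> V) = {}" if "S \<in> \<pi>" for S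
        using partition_on_same[OF \<sigma> _ V(2), of S] that by (auto simp: \<pi>_def)
      have dj: "disjnt (b \<union> V) (\<Union>\<pi>)" unfolding disjnt_def using other by blast
      have "\<Union>(insert b P) \<union> U - (b \<union> V) = \<Union>P \<union> (U - V)" using bP bU UP V by auto
      then have pi: "partition_on (\<Union>P \<union> (U - V)) \<pi>"
        using partition_on_insert[OF dj] \<sigma> ins by auto
      have "\<exists>W. W \<subseteq> (U - V) \<inter> A c \<and> c \<union> W \<in> \<pi>" if "c \<in> P" for c
      proof -
        obtain W where W: "W \<subseteq> U \<inter> A c" "c \<union> W \<in> \<sigma>" using bspec[OF ext, of c] \<open>c \<in> P\<close> by auto
        have "c \<union> W \<noteq> b \<union> V"
        proof
          assume "c \<union> W = b \<union> V"
          then have "b \<subseteq> c \<union> W" by auto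
          moreover have "b \<inter> c = {}" "b \<inter> W = {}" using bP that bU W by auto
          ultimately show False using P(3) by auto
        qed
        then have "c \<union> W \<in> \<pi>" using W by (auto simp: \<pi>_def)
        moreover have "W \<subseteq> (U - V)" using other[OF \<open>c \<union> W \<in> \<pi>\<close>] W by auto
        ultimately show ?thesis using W by blast
      qed
      then have "\<pi> \<in> block_extensions P (U - V) A" using pi unfolding block_extensions_def by blast
      then show "\<sigma> \<in> (\<lambda>(V, \<pi>). insert (b \<union> V) \<pi>) ` (SIGMA V:Pow (U \<inter> A b). block_extensions P (U - V) A)"
        using V ins by (auto intro!: image_eqI[where x = "(V, \<pi>)"])
    qed
  qed
qed

text \<open>Induction on the marked blocks. With none left, \<open>U\<close> is partitioned freely,
  which is the value of the functional at \<open>X ^ card U\<close>. A further block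
  \<open>b\<close> chooses its set \<open>V\<close>, and summing over \<open>V\<close> raises the
  constant by 1 in the factor of each \<open>y\<close> that \<open>b\<close> tolerates.\<close>

lemma card_block_extensions:
  fixes P :: "'a set set"
  assumes "finite P" "disjoint P" "{} \<notin> P" "finite (\<Union>P)" "finite U" "U \<inter> \<Union>P = {}"
  shows "of_nat (card (block_extensions P U A))
       = bell_eval (\<Prod>y\<in>U. [:of_nat (card {b \<in> P. y \<in> A b}), 1:] :: 'b::comm_ring_1 poly)"
  using assms
proof (induction P arbitrary: U)
  case empty
  then show ?case
    by (simp add: block_extensions_def card_partitions_eq_bell bell_eval_X_power)
next
  case (insert b P)
  let ?w = "\<lambda>P y. [:of_nat (card {b \<in> P. y \<in> A b}), 1:] :: 'b poly"
  have dj: "disjoint P" using insert.prems(1) by (simp add: pairwise_insert)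
  have "card (block_extensions (insert b P) U A)
      = card (SIGMA V:Pow (U \<inter> A b). block_extensions P (U - V) A)"
    by (rule bij_betw_same_card[OF block_extensions_insert, symmetric])
       (use insert.prems insert.hyps in auto)
  also have "\<dots> = (\<Sum>V\<in>Pow (U \<inter> A b). card (block_extensions P (U - V) A))"
    by (rule card_SigmaI) (use insert.prems in \<open>auto intro!: finite_block_extensions\<close>)
  finally have "of_nat (card (block_extensions (insert b P) U A))
      = (\<Sum>V\<in>Pow (U \<inter> A b). of_nat (card (block_extensions P (U - V) A)) :: 'b)"
    by simp
  also have "\<dots> = (\<Sum>V\<in>Pow (U \<inter> A b). bell_eval (\<Prod>y\<in>U - V. ?w P y))"
    by (intro sum.cong insert.IH dj) (use insert.prems in auto)
  also have "\<dots> = bell_eval (\<Sum>V\<in>Pow (U \<inter> A b). \<Prod>y\<in>U - V. ?w P y)"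
    by (simp add: bell_eval_sum)
  \<comment> \<open>The indicator product kills every \<open>V\<close> with an element outside
    \<open>A b\<close>. The sum over all subsets of \<open>U\<close> is then the expansion of a
    product of two-term factors, which \<open>prod_add\<close> folds up.\<close>
  also have "(\<Sum>V\<in>Pow (U \<inter> A b). \<Prod>y\<in>U - V. ?w P y)
           = (\<Sum>V\<in>Pow U. (\<Prod>y\<in>V. if y \<in> A b then 1 else 0) * (\<Prod>y\<in>U - V. ?w P y))"
  proof (rule sum.mono_neutral_cong_left)
    show "\<forall>V\<in>Pow U - Pow (U \<inter> A b).
            (\<Prod>y\<in>V. if y \<in> A b then 1 else 0) * (\<Prod>y\<in>U - V. ?w P y) = 0"
    proof
      fix V assume V: "V \<in> Pow U - Pow (U \<inter> A b)"
      then obtain y where "y \<in> V" "y \<notin> A b" by auto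
      moreover have "finite V" using V insert.prems(4) by (auto intro: finite_subset)
      ultimately have "(\<Prod>y\<in>V. if y \<in> A b then 1 else 0 :: 'b poly) = 0" by (intro prod_zero) auto
      then show "(\<Prod>y\<in>V. if y \<in> A b then 1 else 0) * (\<Prod>y\<in>U - V. ?w P y) = 0" by simp
    qed
  next
    fix V assume "V \<in> Pow (U \<inter> A b)"
    then have "(\<Prod>y\<in>V. if y \<in> A b then 1 else 0 :: 'b poly) = 1" by (intro prod.neutral) auto
    then show "(\<Prod>y\<in>U - V. ?w P y)
             = (\<Prod>y\<in>V. if y \<in> A b then 1 else 0) * (\<Prod>y\<in>U - V. ?w P y)" by simp
  qed (use insert.prems in auto)
  also have "\<dots> = (\<Prod>y\<in>U. (if y \<in> A b then 1 else 0) + ?w P y)"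
    using insert.prems by (simp add: prod_add)
  also have "\<dots> = (\<Prod>y\<in>U. ?w (insert b P) y)"
  proof (rule prod.cong[OF refl])
    fix y
    have "{c \<in> insert b P. y \<in> A c} = (if y \<in> A b then insert b {c \<in> P. y \<in> A c} else {c \<in> P. y \<in> A c})"
      by auto
    then show "(if y \<in> A b then 1 else 0) + ?w P y = ?w (insert b P) y"
      using insert.hyps by (auto simp: one_pCons)
  qed
  finally show ?case .
qed

section \<open>Umbral shift identities\<close>

lemma bell_eval_shift_power: "bell_eval ([:1, 1:] ^ n) = (of_nat (bell (int n + 1)) :: 'b::comm_ring_1)"
proof -
  \<comment> \<open>Mark only \<open>Suc n\<close> and let its block tolerate everything: every
    partition qualifies, and each of the \<open>n\<close> other elements has weight
    \<open>X + 1\<close>.\<close>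
  have "block_extensions {{Suc n}} {1..n} (\<lambda>_. UNIV) = {P. partition_on {1..Suc n} P}" (is "?L = ?R")
  proof (intro set_eqI iffI)
    fix \<pi> assume "\<pi> \<in> ?R"
    then have \<pi>: "partition_on {1..Suc n} \<pi>" by simp
    then have "Suc n \<in> \<Union>\<pi>" using partition_onD1[OF \<pi>] by auto
    then obtain S where S: "S \<in> \<pi>" "Suc n \<in> S" by blast
    then have "S \<subseteq> {1..Suc n}" using \<pi> unfolding partition_on_def by blast
    then have "S - {Suc n} \<subseteq> {1..n}" by (auto simp: le_Suc_eq)
    moreover have "{Suc n} \<union> (S - {Suc n}) = S" using S by auto
    moreover have "{1..Suc n} = \<Union>{{Suc n}} \<union> {1..n}" by auto
    ultimately have "S - {Suc n} \<subseteq> {1..n} \<inter> UNIV \<and> {Suc n} \<union> (S - {Suc n}) \<in> \<pi>"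
      "partition_on (\<Union>{{Suc n}} \<union> {1..n}) \<pi>"
      using \<pi> S by simp_all
    then show "\<pi> \<in> ?L" unfolding block_extensions_def by blast
  next
    fix \<pi> assume "\<pi> \<in> ?L"
    moreover have "{1..Suc n} = \<Union>{{Suc n}} \<union> {1..n}" by auto
    ultimately show "\<pi> \<in> ?R" unfolding block_extensions_def by simp
  qed
  moreover have "card {P. partition_on {1..Suc n} P} = bell (int n + 1)"
    by (subst card_partitions_eq_bell) (auto simp: add.commute)
  moreover have "of_nat (card (block_extensions {{Suc n}} {1..n} (\<lambda>_. UNIV)))
      = bell_eval (\<Prod>y\<in>{1..n}. [:of_nat (card {b \<in> {{Suc n}}. y \<in> UNIV}), 1:] :: 'b poly)"
    by (rule card_block_extensions) auto
  moreover have "{b \<in> {{Suc n}}. y \<in> UNIV} = {{Suc n}}" for y :: nat by auto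
  ultimately show ?thesis by simp
qed

text \<open>By linearity only \<open>f = X ^ i\<close> matters, where both sides are the Bell number
  of index \<open>i + 1\<close>.\<close>

lemma bell_eval_pcompose_1: "bell_eval (f \<circ>\<^sub>p [:1, 1:]) = bell_eval ([:0, 1:] * f)"
proof -
  have f: "f = (\<Sum>i\<le>degree f. smult (coeff f i) ([:0, 1:] ^ i))"
    using poly_as_sum_of_monoms[of f] by (simp add: monom_altdef)
  have pc: "([:0, 1:] ^ i) \<circ>\<^sub>p [:1, 1:] = ([:1, 1:] ^ i :: 'a poly)" for i
    by (induction i) (simp_all add: pcompose_1 pcompose_mult pcompose_pCons)
  have "bell_eval (f \<circ>\<^sub>p [:1, 1:]) = (\<Sum>i\<le>degree f. coeff f i * of_nat (bell (int i + 1)))"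
    by (subst f) (simp add: pcompose_sum pcompose_smult pc bell_eval_sum bell_eval_smult
        bell_eval_shift_power)
  also have "\<dots> = (\<Sum>i\<le>degree f. bell_eval (smult (coeff f i) ([:0, 1:] ^ Suc i)))"
    by (simp add: bell_eval_smult bell_eval_X_power add.commute del: power_Suc)
  also have "\<dots> = bell_eval ([:0, 1:] * (\<Sum>i\<le>degree f. smult (coeff f i) ([:0, 1:] ^ i)))"
    by (simp add: bell_eval_sum sum_distrib_left)
  finally show ?thesis using f by simp
qed

definition falling_poly :: "nat \<Rightarrow> 'a::comm_ring_1 poly" where
  "falling_poly a = (\<Prod>l<a. [:- of_nat l, 1:])"

text \<open>Split off one unit of the shift; it yields a factor \<open>X\<close>. Written as
  \<open>X - a\<close> composed with \<open>X + a\<close>, that factor passes under the remaining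
  shift and becomes the next factor of the falling factorial.\<close>

lemma bell_eval_pcompose: "bell_eval (f \<circ>\<^sub>p [:of_nat a, 1:]) = bell_eval (falling_poly a * f)"
proof (induction a arbitrary: f)
  case 0
  then show ?case by (simp add: falling_poly_def)
next
  case (Suc a)
  have sub: "[:- of_nat a, 1:] \<circ>\<^sub>p [:of_nat a, 1:] = ([:0, 1:] :: 'a poly)"
    by (simp add: pcompose_pCons)
  have comp: "f \<circ>\<^sub>p [:of_nat (Suc a), 1:] = (f \<circ>\<^sub>p [:of_nat a, 1:]) \<circ>\<^sub>p [:1, 1:]"
    by (simp add: pcompose_assoc[symmetric] pcompose_pCons add.commute)
  have "bell_eval (f \<circ>\<^sub>p [:of_nat (Suc a), 1:]) = bell_eval ([:0, 1:] * (f \<circ>\<^sub>p [:of_nat a, 1:]))"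
    unfolding comp by (rule bell_eval_pcompose_1)
  also have "\<dots> = bell_eval (([:- of_nat a, 1:] * f) \<circ>\<^sub>p [:of_nat a, 1:])"
    by (simp only: pcompose_mult sub)
  also have "\<dots> = bell_eval (falling_poly (Suc a) * f)"
    unfolding Suc.IH falling_poly_def prod.lessThan_Suc by (simp only: mult.assoc)
  finally show ?case .
qed

section \<open>Uniqueness of shifted Bell polynomials\<close>

lemma const_poly_dvd_of_values:
  fixes f :: "int poly"
  assumes "prime p" "d \<le> p" "degree f < d" "\<And>j. j < d \<Longrightarrow> int p dvd poly f (int j)"
  shows "[:int p:] dvd f"
  using assms(2-)
proof (induction d arbitrary: f)
  case 0
  then show ?case by simp
next
  case (Suc d)
  \<comment> \<open>Divide off the root \<open>d\<close> modulo \<open>p\<close>. The quotient still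
    has the roots \<open>0, ..., d - 1\<close> modulo \<open>p\<close>, because \<open>d - j\<close>
    is positive and less than \<open>p\<close> for \<open>j < d\<close>.\<close>
  define h where "h = synthetic_div f (int d)"
  have f: "f = [:- int d, 1:] * h + [:poly f (int d):]"
    using synthetic_div_correct'[of "int d" f] by (simp add: h_def)
  have "[:int p:] dvd h"
  proof (cases "d = 0")
    case True
    then have "h = 0" using Suc.prems by (simp add: h_def synthetic_div_eq_0_iff)
    then show ?thesis by simp
  next
    case False
    show ?thesis
    proof (rule Suc.IH)
      show "degree h < d" using Suc.prems False by (simp add: h_def degree_synthetic_div)
      fix j assume j: "j < d"
      have "poly f (int j) = (int j - int d) * poly h (int j) + poly f (int d)"
        by (subst f) (simp add: algebra_simps)
      then have "(int j - int d) * poly h (int j) = poly f (int j) - poly f (int d)" by simp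
      moreover have "int p dvd poly f (int j) - poly f (int d)"
        using Suc.prems j by (intro dvd_diff) auto
      ultimately have "int p dvd (int j - int d) * poly h (int j)" by simp
      moreover have "\<not> int p dvd int j - int d"
      proof
        assume "int p dvd int j - int d"
        then have "int p dvd int (d - j)"
          using j by (subst dvd_minus_iff[symmetric]) (simp add: of_nat_diff)
        then have "p dvd d - j" by (simp only: of_nat_dvd_iff)
        then show False using j Suc.prems by (auto dest!: dvd_imp_le)
      qed
      ultimately show "int p dvd poly h (int j)"
        using assms(1) by (simp add: prime_dvd_mult_iff)
    qed (use Suc.prems in auto)
  qed
  moreover have "[:int p:] dvd [:poly f (int d):]" using Suc.prems by simp
  ultimately show ?case by (subst f) (intro dvd_add dvd_mult)
qed

lemma falling_poly_monic:
  "degree (falling_poly a :: 'a::idom poly) = a \<and> lead_coeff (falling_poly a :: 'a poly) = 1"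
proof (induction a)
  case 0
  then show ?case by (simp add: falling_poly_def)
next
  case (Suc a)
  have eq: "falling_poly (Suc a) = falling_poly a * ([:- of_nat a, 1:] :: 'a poly)"
    by (simp add: falling_poly_def)
  have "falling_poly a \<noteq> (0 :: 'a poly)" using Suc by auto
  then have "degree (falling_poly (Suc a) :: 'a poly) = Suc a"
    unfolding eq using Suc by (subst degree_mult_eq) auto
  moreover have "lead_coeff (falling_poly (Suc a) :: 'a poly) = 1"
    unfolding eq lead_coeff_mult using Suc by (metis lead_coeff_pCons(1) lead_coeff_1 mult_1_left one_neq_zero one_pCons pCons_eq_0_iff)
  ultimately show ?case by blast
qed

text \<open>Fermat's little theorem: modulo \<open>p\<close> only the outer terms of the binomial
  expansion of \<open>(j + 1) ^ p\<close> survive.\<close>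

lemma prime_dvd_power_diff:
  assumes "prime p"
  shows "int p dvd int j ^ p - int j"
proof (induction j)
  case 0
  then show ?case using prime_gt_0_nat[OF assms] by (simp add: zero_power)
next
  case (Suc j)
  have p: "p > 0" using assms by (rule prime_gt_0_nat)
  let ?t = "\<lambda>i. int (p choose i) * int j ^ i"
  have "int (Suc j) ^ p = (\<Sum>i\<le>p. ?t i)"
    using binomial_ring[of "int j" 1 p] by (simp add: add.commute)
  also have "{..p} = insert 0 (insert p {0<..<p})" using p by auto
  also have "(\<Sum>i\<in>insert 0 (insert p {0<..<p}). ?t i) = 1 + int j ^ p + (\<Sum>i\<in>{0<..<p}. ?t i)"
    using p by simp
  finally have "int (Suc j) ^ p - int (Suc j) = (int j ^ p - int j) + (\<Sum>i\<in>{0<..<p}. ?t i)"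
    by simp
  moreover have "int p dvd (\<Sum>i\<in>{0<..<p}. ?t i)"
  proof (intro dvd_sum dvd_mult2)
    fix i assume "i \<in> {0<..<p}"
    then have "p dvd (p choose i)" by (intro dvd_choose_prime) (use assms in auto)
    then show "int p dvd int (p choose i)" by simp
  qed
  ultimately show ?case using Suc by (metis dvd_add)
qed

text \<open>Both polynomials are monic of degree \<open>p\<close>, so their difference has degree
  below \<open>p\<close>. It vanishes modulo \<open>p\<close> at the \<open>p\<close> residues,
  hence all its coefficients do.\<close>

lemma falling_poly_prime:
  assumes "prime p"
  shows "[:int p:] dvd falling_poly p - ([:0, 1:] ^ p - [:0, 1:])"
proof (rule const_poly_dvd_of_values[OF assms, of p])
  let ?g = "falling_poly p - ([:0, 1:] ^ p - [:0, 1:]) :: int poly"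
  have p: "p > 1" using assms by (rule prime_gt_1_nat)
  have X: "[:0, 1:] ^ p = (monom 1 p :: int poly)" by (simp add: monom_altdef)
  have "degree ?g \<le> p"
    using falling_poly_monic[of p, where 'a = int] p
    by (intro degree_diff_le) (auto simp: X degree_monom_eq)
  moreover have "coeff ?g p = 0"
  proof -
    have "coeff (falling_poly p :: int poly) p = 1" by (metis falling_poly_monic)
    moreover have "coeff [:0, 1 :: int:] p = 0" using p by (simp add: coeff_eq_0)
    ultimately show ?thesis by (simp add: X)
  qed
  ultimately show "degree ?g < p"
    by (metis degree_0 leading_coeff_0_iff le_neq_implies_less p gr_implies_not_zero neq0_conv)
  fix j assume j: "j < p"
  have "poly (falling_poly p) (int j) = 0"
    using j by (auto simp: falling_poly_def poly_prod intro!: prod_zero bexI[of _ j])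
  moreover have "int p dvd int j ^ p - int j" by (rule prime_dvd_power_diff[OF assms])
  ultimately show "int p dvd poly ?g (int j)"
    by (simp add: dvd_diff_commute)
qed simp

lemma bell_eval_const_dvd:
  assumes "[:c:] dvd f"
  shows "c dvd bell_eval f"
proof -
  obtain g where "f = smult c g" using assms by (auto elim!: dvdE)
  then show ?thesis by (simp add: bell_eval_smult)
qed

text \<open>Modulo \<open>p\<close>, \<open>X ^ p\<close> is \<open>falling_poly p + X\<close>. The
  functional turns \<open>falling_poly p * X ^ n\<close> into the value at
  \<open>(X + p) ^ n\<close>, which is congruent to that at \<open>X ^ n\<close>; the other summand
  gives \<open>X ^ (n + 1)\<close>.\<close>

lemma touchard_congruence:
  assumes "prime p"
  shows "int p dvd int (bell (int (n + p))) - int (bell (int n)) - int (bell (int (n + 1)))"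
proof -
  let ?X = "[:0, 1:] :: int poly"
  define g where "g = falling_poly p - (?X ^ p - ?X)"
  have "?X ^ p = falling_poly p + ?X - g" by (simp add: g_def)
  then have "?X ^ (n + p) = falling_poly p * ?X ^ n + ?X ^ (n + 1) - g * ?X ^ n"
    unfolding power_add power_one_right by (simp only: ring_distribs mult.commute)
  moreover have "(?X ^ n) \<circ>\<^sub>p [:of_nat p, 1:] = [:int p, 1:] ^ n"
    by (induction n) (simp_all add: pcompose_1 pcompose_mult pcompose_pCons)
  ultimately have "bell_eval (?X ^ (n + p))
      = bell_eval ([:int p, 1:] ^ n) + bell_eval (?X ^ (n + 1)) - bell_eval (g * ?X ^ n)"
    by (simp only: bell_eval_diff bell_eval_add bell_eval_pcompose[symmetric])
  then have "int (bell (int (n + p))) - int (bell (int n)) - int (bell (int (n + 1)))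
      = bell_eval ([:int p, 1:] ^ n - ?X ^ n) - bell_eval (g * ?X ^ n)"
    by (simp only: bell_eval_diff bell_eval_X_power of_int_of_nat_eq)
  moreover have "[:int p:] dvd [:int p, 1:] ^ n - ?X ^ n"
  proof (induction n)
    case (Suc n)
    have "[:int p, 1:] ^ Suc n - ?X ^ Suc n
        = [:int p:] * [:int p, 1:] ^ n + ?X * ([:int p, 1:] ^ n - ?X ^ n)"
      by (simp add: algebra_simps)
    then show ?case using Suc by (metis dvd_add dvd_mult dvd_triv_left)
  qed simp
  moreover have "[:int p:] dvd g * ?X ^ n"
    unfolding g_def by (intro dvd_mult2 falling_poly_prime assms)
  ultimately show ?thesis by (simp add: bell_eval_const_dvd)
qed

section \<open>Growth of the Bell numbers\<close>

lemma bell_pos: "bell (int n) > 0"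
proof -
  have "partition_on {1..n} ((\<lambda>x. {x}) ` {1..n})" by (rule partition_on_singletons)
  then show ?thesis
    using finitely_many_partition_on[of "{1..n}"]
    by (auto simp: bell_def set_partitions_def card_gt_0_iff)
qed

lemma bell_Suc: "bell (int n + 1) = (\<Sum>i\<le>n. (n choose i) * bell (int i))"
proof -
  have "int (bell (int n + 1)) = bell_eval ([:1, 1:] ^ n)" by (simp add: bell_eval_shift_power)
  also have "[:1, 1:] ^ n = ([:0, 1:] + 1 :: int poly) ^ n" by (simp add: one_pCons)
  also have "\<dots> = (\<Sum>i\<le>n. smult (int (n choose i)) ([:0, 1:] ^ i))"
    by (subst binomial_ring) (simp add: of_nat_poly)
  also have "bell_eval \<dots> = int (\<Sum>i\<le>n. (n choose i) * bell (int i))"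
    by (simp add: bell_eval_sum bell_eval_smult bell_eval_X_power)
  finally show ?thesis by (simp only: of_nat_eq_iff)
qed

lemma bell_Suc_ge: "i \<le> n \<Longrightarrow> (n choose i) * bell (int i) \<le> bell (int n + 1)"
  unfolding bell_Suc by (rule member_le_sum[of i "{..n}"]) auto

lemma bell_mono: "m \<le> n \<Longrightarrow> bell (int m) \<le> bell (int n)"
proof (induction rule: dec_induct)
  case (step n)
  then show ?case using bell_Suc_ge[of n n] by (simp add: add.commute)
qed simp

text \<open>Solving for the highest nonzero coefficient would bound the ratio of consecutive Bell
  numbers by a constant \<open>C\<close>. But \<open>B_m\<close> is at least
  \<open>(m - 1) * B_(m-2)\<close>, so over two steps the ratio is unbounded.\<close>

lemma bell_not_linear_recurrent:
  fixes c :: "nat \<Rightarrow> int"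
  assumes "\<And>i. (\<Sum>j\<le>J. c j * int (bell (int (n + i + j)))) = 0"
  shows "\<forall>j\<le>J. c j = 0"
proof (rule ccontr)
  assume "\<not> (\<forall>j\<le>J. c j = 0)"
  then have ne: "{j. j \<le> J \<and> c j \<noteq> 0} \<noteq> {}" by auto
  define M where "M = Max {j. j \<le> J \<and> c j \<noteq> 0}"
  have fin: "finite {j. j \<le> J \<and> c j \<noteq> 0}" by auto
  have M: "M \<le> J" "c M \<noteq> 0" using Max_in[OF fin ne] by (auto simp: M_def)
  have above: "c j = 0" if "M < j" "j \<le> J" for j
  proof (rule ccontr)
    assume "c j \<noteq> 0"
    then have "j \<le> M" unfolding M_def using that by (intro Max_ge fin) simp
    then show False using that by simp
  qed
  define C where "C = (\<Sum>j<M. \<bar>c j\<bar>)"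
  have step: "int (bell (int (n + i + M))) \<le> C * int (bell (int (n + i + M - 1)))" for i
  proof -
    have "0 = (\<Sum>j\<le>J. c j * int (bell (int (n + i + j))))" using assms by simp
    also have "\<dots> = (\<Sum>j\<le>M. c j * int (bell (int (n + i + j))))"
      by (rule sum.mono_neutral_right) (use M above in auto)
    also have "\<dots> = (\<Sum>j<M. c j * int (bell (int (n + i + j)))) + c M * int (bell (int (n + i + M)))"
      by (simp add: lessThan_Suc_atMost[symmetric])
    finally have "\<bar>c M\<bar> * int (bell (int (n + i + M)))
        = \<bar>\<Sum>j<M. c j * int (bell (int (n + i + j)))\<bar>"
      by (smt (verit) abs_mult abs_minus_cancel abs_of_nonneg of_nat_0_le_iff)
    also have "\<dots> \<le> (\<Sum>j<M. \<bar>c j\<bar> * int (bell (int (n + i + j))))"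
      by (rule order_trans[OF sum_abs]) (simp add: abs_mult)
    also have "\<dots> \<le> (\<Sum>j<M. \<bar>c j\<bar> * int (bell (int (n + i + M - 1))))"
      by (intro sum_mono mult_left_mono) (auto intro!: bell_mono simp del: of_nat_add of_nat_diff)
    also have "\<dots> = C * int (bell (int (n + i + M - 1)))"
      by (simp add: C_def sum_distrib_right)
    finally have "\<bar>c M\<bar> * int (bell (int (n + i + M))) \<le> C * int (bell (int (n + i + M - 1)))" .
    \<comment> \<open>Coefficients are integers, so the nonzero \<open>c M\<close> has absolute
      value at least 1.\<close>
    moreover have "1 * int (bell (int (n + i + M))) \<le> \<bar>c M\<bar> * int (bell (int (n + i + M)))"
      by (rule mult_right_mono) (use M in auto)
    ultimately show ?thesis by linarith
  qed
  have C0: "C \<ge> 0" by (simp add: C_def sum_nonneg)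
  \<comment> \<open>Large enough that \<open>m - 1\<close> exceeds \<open>C * C\<close>, the factor
    that two uses of \<open>step\<close> allow. The added 4 keeps \<open>i - 1\<close> and
    \<open>m - 2\<close> free of truncation.\<close>
  define i where "i = nat (C * C) + 4"
  define m where "m = n + i + M"
  have m: "m \<ge> 4" "int m > C * C + 1" by (auto simp: m_def i_def)
  define b where "b = int (bell (int (m - 2)))"
  have "int (bell (int m)) \<le> C * int (bell (int (m - 1)))"
    using step[of i] by (simp only: m_def)
  also have "\<dots> \<le> C * (C * b)"
    using step[of "i - 1"] C0
    by (intro mult_left_mono) (simp_all add: m_def i_def b_def numeral_eq_Suc)
  finally have "int (bell (int m)) \<le> C * C * b" by (simp add: mult.assoc)
  \<comment> \<open>This is the single term of index \<open>m - 2\<close> in the recurrence for the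
    Bell number of \<open>m\<close>.\<close>
  moreover have "int (m - 1) * b \<le> int (bell (int m))"
  proof -
    have "(m - 1 choose (m - 2)) = m - 1"
      using m binomial_symmetric[of "m - 2" "m - 1"] by (simp add: numeral_eq_Suc)
    then have "(m - 1) * bell (int (m - 2)) \<le> bell (int (m - 1) + 1)"
      using bell_Suc_ge[of "m - 2" "m - 1"] by simp
    moreover have "int (m - 1) + 1 = int m" using m by simp
    ultimately show ?thesis unfolding b_def by (metis of_nat_mult of_nat_le_iff)
  qed
  moreover have "C * C * b < int (m - 1) * b"
    by (rule mult_strict_right_mono) (use m bell_pos[of "m - 2"] in \<open>simp_all add: b_def\<close>)
  ultimately show False by linarith
qed

section \<open>Independence over polynomial coefficients\<close>

lemma dvd_all_primes_imp_0:
  assumes "\<And>p. prime p \<Longrightarrow> int p dvd a"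
  shows "a = 0"
proof (rule ccontr)
  assume "a \<noteq> 0"
  obtain p where p: "prime p" "p > nat \<bar>a\<bar>" using bigger_prime by blast
  have "int p \<le> \<bar>a\<bar>"
    using assms[OF p(1)] \<open>a \<noteq> 0\<close> by (metis dvd_imp_le_int abs_of_nat)
  then show False using p by linarith
qed

lemma poly_int_shift_dvd:
  fixes f :: "int poly"
  shows "d dvd poly f (x + d) - poly f x"
proof (induction f)
  case (pCons a f)
  have "poly (pCons a f) (x + d) - poly (pCons a f) x
      = x * (poly f (x + d) - poly f x) + d * poly f (x + d)"
    by (simp add: algebra_simps)
  then show ?case using pCons by (metis dvd_add dvd_mult dvd_triv_left)
qed simp

lemma bell_not_poly_recurrent_int:
  fixes Q :: "nat \<Rightarrow> int poly"
  assumes "\<And>n. n \<ge> n0 \<Longrightarrow> (\<Sum>j\<le>J. poly (Q j) (int n) * int (bell (int (n + j)))) = 0"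
  shows "\<forall>j\<le>J. Q j = 0"
proof -
  \<comment> \<open>The shift \<open>i\<close> moves the Bell numbers but not the argument of the
    coefficients. A fixed sum divisible by every prime is 0, so it is enough to work modulo
    \<open>p\<close>, by induction on \<open>i\<close> for all \<open>n\<close> at once.\<close>
  have zero: "(\<Sum>j\<le>J. poly (Q j) (int n) * int (bell (int (n + i + j)))) = 0" if "n \<ge> n0" for n i
  proof (rule dvd_all_primes_imp_0)
    fix p :: nat assume p: "prime p"
    show "int p dvd (\<Sum>j\<le>J. poly (Q j) (int n) * int (bell (int (n + i + j))))"
      using that
    proof (induction i arbitrary: n)
      case 0
      then show ?case using assms[of n] by simp
    next
      case (Suc i)
      let ?b = "\<lambda>m. int (bell (int m))"
      \<comment> \<open>An exact identity: the relation for \<open>i\<close> at \<open>n + p\<close>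
        minus the one at \<open>n\<close>, and a last sum collecting the errors of replacing
        \<open>n + p\<close> by \<open>n\<close> in the coefficients and of Touchard's
        congruence.\<close>
      have eq: "(\<Sum>j\<le>J. poly (Q j) (int n) * ?b (n + Suc i + j))
          = (\<Sum>j\<le>J. poly (Q j) (int (n + p)) * ?b (n + p + i + j))
            - (\<Sum>j\<le>J. poly (Q j) (int n) * ?b (n + i + j))
            - (\<Sum>j\<le>J. (poly (Q j) (int n + int p) - poly (Q j) (int n)) * ?b (n + p + i + j)
                + poly (Q j) (int n) * (?b (n + i + j + p) - ?b (n + i + j) - ?b (n + i + j + 1)))"
        unfolding sum_subtractf[symmetric]
        by (rule sum.cong[OF refl]) (simp add: algebra_simps)
      have d1: "int p dvd (\<Sum>j\<le>J. poly (Q j) (int (n + p)) * ?b (n + p + i + j))"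
        using Suc.prems by (intro Suc.IH) simp
      have d2: "int p dvd (\<Sum>j\<le>J. poly (Q j) (int n) * ?b (n + i + j))"
        using Suc.prems by (intro Suc.IH)
      have d3: "int p dvd
          (\<Sum>j\<le>J. (poly (Q j) (int n + int p) - poly (Q j) (int n)) * ?b (n + p + i + j)
                + poly (Q j) (int n) * (?b (n + i + j + p) - ?b (n + i + j) - ?b (n + i + j + 1)))"
        by (intro dvd_sum dvd_add dvd_mult2[OF poly_int_shift_dvd] dvd_mult[OF touchard_congruence[OF p]])
      show ?case unfolding eq by (intro dvd_diff d1 d2 d3)
    qed
  qed
  \<comment> \<open>With \<open>n\<close> fixed, \<open>zero\<close> is a recurrence in
    \<open>i\<close> with constant coefficients. So each \<open>Q j\<close> vanishes at all
    \<open>n \<ge> n0\<close> and has infinitely many roots.\<close>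
  have root: "poly (Q j) (int n) = 0" if "n \<ge> n0" "j \<le> J" for n j
    using bell_not_linear_recurrent[where J = J and c = "\<lambda>j. poly (Q j) (int n)" and n = n] zero[OF that(1)] that(2)
    by blast
  show ?thesis
  proof (intro allI impI, rule ccontr)
    fix j assume j: "j \<le> J" "Q j \<noteq> 0"
    have "int ` {n0..} \<subseteq> {x. poly (Q j) x = 0}" using root j by auto
    then have "finite (int ` {n0..})" using poly_roots_finite[OF j(2)] finite_subset by blast
    then show False by (simp add: finite_image_iff infinite_Ici)
  qed
qed

lemma rat_poly_clear_denominators:
  fixes f :: "rat poly"
  shows "\<exists>d g. d \<noteq> 0 \<and> smult (of_int d) f = map_poly of_int g"
proof (induction f)
  case 0
  show ?case by (intro exI[of _ 1] exI[of _ 0]) simp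
next
  case (pCons a f)
  then obtain d g where dg: "d \<noteq> 0" "smult (of_int d) f = map_poly of_int g" by blast
  obtain u v where uv: "a = of_int u / of_int v" "v > 0"
    by (metis Fract_of_int_quotient Rat_cases)
  have "smult (of_int (d * v)) (pCons a f) = pCons (of_int (d * u)) (smult (of_int v) (smult (of_int d) f))"
    using uv by (simp add: mult.commute)
  also have "\<dots> = map_poly of_int (pCons (d * u) (smult v g))"
    unfolding dg by (rule poly_eqI) (simp add: coeff_pCons coeff_map_poly split: nat.split)
  finally show ?case using dg uv by (intro exI[of _ "d * v"] exI[of _ "pCons (d * u) (smult v g)"]) simp
qed

lemma poly_of_int_map:
  "of_int (poly f (int n)) = poly (map_poly of_int f) (of_nat n :: rat)"
  by (induction f) (simp_all add: map_poly_pCons)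

lemma bell_not_poly_recurrent:
  fixes q :: "nat \<Rightarrow> rat poly"
  assumes "\<And>n. n \<ge> n0 \<Longrightarrow> (\<Sum>j\<le>J. poly (q j) (of_nat n) * of_nat (bell (int (n + j)))) = 0"
  shows "\<forall>j\<le>J. q j = 0"
proof -
  obtain d g where dg: "\<And>j. d j \<noteq> 0" "\<And>j. smult (of_int (d j)) (q j) = map_poly of_int (g j)"
  proof -
    have "\<forall>j. \<exists>d g. d \<noteq> 0 \<and> smult (of_int d) (q j) = map_poly of_int g"
      using rat_poly_clear_denominators by blast
    from choice[OF this] obtain d
      where "\<forall>j. \<exists>g. d j \<noteq> 0 \<and> smult (of_int (d j)) (q j) = map_poly of_int g" by blast
    from choice[OF this] show ?thesis using that by blast
  qed
  \<comment> \<open>The cofactor of \<open>d j\<close> in the common denominator: \<open>Q j\<close>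
    is the integer form of \<open>q j\<close> times the product of all \<open>d i\<close>.\<close>
  define D where "D j = (\<Prod>i\<in>{..J} - {j}. d i)" for j
  define Q where "Q j = smult (D j) (g j)" for j
  have D0: "D j \<noteq> 0" for j using dg by (simp add: D_def)
  have Q: "of_int (poly (Q j) (int n)) = of_int (\<Prod>i\<le>J. d i) * poly (q j) (of_nat n)" if "j \<le> J" for j n
  proof -
    have "of_int (poly (g j) (int n)) = poly (map_poly of_int (g j)) (of_nat n :: rat)"
      by (rule poly_of_int_map)
    also have "\<dots> = of_int (d j) * poly (q j) (of_nat n)" by (simp flip: dg(2))
    finally show ?thesis
      using that by (simp add: Q_def D_def prod.remove[of "{..J}" j])
  qed
  have "\<forall>j\<le>J. Q j = 0"
  proof (rule bell_not_poly_recurrent_int)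
    fix n assume n: "n \<ge> n0"
    have "of_int (\<Sum>j\<le>J. poly (Q j) (int n) * int (bell (int (n + j))))
        = (\<Sum>j\<le>J. of_int (\<Prod>i\<le>J. d i) * poly (q j) (of_nat n) * of_nat (bell (int (n + j))) :: rat)"
      unfolding of_int_sum of_int_mult of_int_of_nat_eq
      by (intro sum.cong refl) (simp add: Q)
    also have "\<dots> = of_int (\<Prod>i\<le>J. d i) * (\<Sum>j\<le>J. poly (q j) (of_nat n) * of_nat (bell (int (n + j))))"
      by (simp add: sum_distrib_left mult.assoc)
    also have "\<dots> = 0" using assms[OF n] by simp
    finally show "(\<Sum>j\<le>J. poly (Q j) (int n) * int (bell (int (n + j)))) = 0" by linarith
  qed
  then have "\<forall>j\<le>J. g j = 0" using D0 by (simp add: Q_def)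
  then show ?thesis using dg by (metis map_poly_0 of_int_eq_0_iff smult_eq_0_iff)
qed

text \<open>Replacing \<open>n\<close> by \<open>n + k\<close> makes all shifts nonnegative, at the
  price of composing the coefficients with \<open>X + k\<close>; this composition kills only
  0.\<close>

lemma shifted_bell_unique:
  fixes q :: "int \<Rightarrow> rat poly"
  assumes "\<And>n. n \<ge> n0 \<Longrightarrow>
      (\<Sum>j=- int k..int M. poly (q j) (of_nat n) * of_nat (bell (int n + j))) = 0"
    and "- int k \<le> j" "j \<le> int M"
  shows "q j = 0"
proof -
  define h where "h i = q (int i - int k) \<circ>\<^sub>p [:of_nat k, 1:]" for i
  have "\<forall>i\<le>k + M. h i = 0"
  proof (rule bell_not_poly_recurrent)
    fix n assume n: "n \<ge> n0"
    have "(\<Sum>i\<le>k + M. poly (h i) (of_nat n) * of_nat (bell (int (n + i))))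
        = (\<Sum>j=- int k..int M. poly (q j) (of_nat (n + k)) * of_nat (bell (int (n + k) + j)))"
      by (rule sum.reindex_bij_witness[of _ "\<lambda>j. nat (j + int k)" "\<lambda>i. int i - int k"])
         (auto simp: h_def poly_pcompose add.commute)
    also have "\<dots> = 0" using assms(1)[of "n + k"] n by simp
    finally show "(\<Sum>i\<le>k + M. poly (h i) (of_nat n) * of_nat (bell (int (n + i)))) = 0" .
  qed
  moreover have "nat (j + int k) \<le> k + M" using assms by linarith
  ultimately have "h (nat (j + int k)) = 0" by blast
  then have "q j \<circ>\<^sub>p [:of_nat k, 1:] = 0" using assms by (simp add: h_def)
  then show ?thesis using pcompose_eq_0_iff[of "[:of_nat k, 1:]" "q j"] by simp
qed

section \<open>Exponential polynomials\<close>

text \<open>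
  The power \<open>T - r\<close> is truncated, harmlessly: the binomial coefficient vanishes when \<open>T < r\<close>.
  It is this vanishing that makes the final formula valid for small \<open>n\<close>. The bound \<open>r \<le> i + g\<close>
  survives multiplication by \<open>T\<close>, which raises \<open>r\<close> and \<open>i\<close> together, and a convolution increases
  only \<open>g\<close>.
\<close>

inductive exp_poly :: "nat \<Rightarrow> nat \<Rightarrow> nat \<Rightarrow> (nat \<Rightarrow> rat poly) \<Rightarrow> bool" for K E g where
  zero: "exp_poly K E g (\<lambda>_. 0)"
| single: "a \<le> K \<Longrightarrow> i \<le> E \<Longrightarrow> r \<le> i + g \<Longrightarrow>
    exp_poly K E g (\<lambda>T. smult (c * of_nat (T choose r)) ([:of_nat a, 1:] ^ (T - r) * [:of_nat a, 1:] ^ i))"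
| add: "exp_poly K E g f \<Longrightarrow> exp_poly K E g h \<Longrightarrow> exp_poly K E g (\<lambda>T. f T + h T)"

section \<open>Closure under linear combinations and multiplication by \<open>T\<close>\<close>

lemma exp_poly_smult: "exp_poly K E g f \<Longrightarrow> exp_poly K E g (\<lambda>T. smult c (f T))"
proof (induction rule: exp_poly.induct)
  case zero
  then show ?case by (simp add: exp_poly.zero)
next
  case (single a i r d)
  then show ?case using exp_poly.single[of a K i E r g "c * d"] by (simp add: mult.assoc)
next
  case (add f h)
  then show ?case using exp_poly.add[OF add.IH] by (simp add: smult_add_right)
qed

lemma exp_poly_mono: "exp_poly K E g f \<Longrightarrow> E \<le> E' \<Longrightarrow> g \<le> g' \<Longrightarrow> exp_poly K E' g' f"
  by (induction rule: exp_poly.induct) (auto intro: exp_poly.intros)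

lemma exp_poly_sum:
  "finite I \<Longrightarrow> (\<And>i. i \<in> I \<Longrightarrow> exp_poly K E g (f i)) \<Longrightarrow> exp_poly K E g (\<lambda>T. \<Sum>i\<in>I. f i T)"
  by (induction I rule: finite_induct) (auto intro: exp_poly.intros)

lemma times_choose: "T * (T choose r) = Suc r * (T choose Suc r) + r * (T choose r)"
proof (cases "r \<le> T")
  case True
  have "(T - r) * (T choose r) = Suc r * (T choose Suc r)" 
    by (simp only: binomial_absorb_comp binomial_absorption)
  moreover have "T * (T choose r) = (T - r) * (T choose r) + r * (T choose r)"
    using True by (simp flip: add_mult_distrib)
  ultimately show ?thesis by simp
qed (simp add: binomial_eq_0)

lemma exp_poly_times_nat:
  "exp_poly K E g f \<Longrightarrow> exp_poly K (Suc E) g (\<lambda>T. smult (of_nat T) (f T))"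
proof (induction rule: exp_poly.induct)
  case zero
  then show ?case by (simp add: exp_poly.zero)
next
  case (single a i r c)
  let ?u = "[:of_nat a, 1:] :: rat poly"
  have "smult (of_nat T) (smult (c * of_nat (T choose r)) (?u ^ (T - r) * ?u ^ i))
      = smult (c * of_nat (Suc r) * of_nat (T choose Suc r)) (?u ^ (T - Suc r) * ?u ^ Suc i)
        + smult (c * of_nat r * of_nat (T choose r)) (?u ^ (T - r) * ?u ^ i)" for T
  proof -
    have "smult (of_nat T) (smult (c * of_nat (T choose r)) (?u ^ (T - r) * ?u ^ i))
        = smult (c * of_nat (T * (T choose r))) (?u ^ (T - r) * ?u ^ i)"
      by (simp add: algebra_simps)
    also have "\<dots> = smult (c * of_nat (Suc r) * of_nat (T choose Suc r)) (?u ^ (T - r) * ?u ^ i)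
        + smult (c * of_nat r * of_nat (T choose r)) (?u ^ (T - r) * ?u ^ i)"
      unfolding times_choose of_nat_add of_nat_mult by (simp only: ring_distribs smult_add_left mult.assoc)
    \<comment> \<open>Raising \<open>r\<close> takes one factor from the first power and raising
      \<open>i\<close> returns it. If \<open>T < Suc r\<close>, the exponents truncate differently
      but the binomial coefficient is 0.\<close>
    also have "smult (c * of_nat (Suc r) * of_nat (T choose Suc r)) (?u ^ (T - r) * ?u ^ i)
        = smult (c * of_nat (Suc r) * of_nat (T choose Suc r)) (?u ^ (T - Suc r) * ?u ^ Suc i)"
    proof (cases "Suc r \<le> T")
      case True
      then have "?u ^ (T - r) = ?u ^ (T - Suc r) * ?u"
        by (metis Suc_diff_Suc Suc_le_lessD power_Suc2)
      then show ?thesis by (simp only: power_Suc mult.assoc)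
    next
      case False
      then have "(T choose Suc r) = 0" by (simp add: binomial_eq_0)
      then show ?thesis by (simp del: binomial_eq_0_iff)
    qed
    finally show ?thesis .
  qed
  moreover have "exp_poly K (Suc E) g
     (\<lambda>T. smult (c * of_nat (Suc r) * of_nat (T choose Suc r)) (?u ^ (T - Suc r) * ?u ^ Suc i)
        + smult (c * of_nat r * of_nat (T choose r)) (?u ^ (T - r) * ?u ^ i))"
    using single by (intro exp_poly.add exp_poly.single) auto
  ultimately show ?case by simp
next
  case (add f h)
  then show ?case using exp_poly.add[OF add.IH] by (simp add: smult_add_right)
qed

text \<open>The offset \<open>s\<close> turns \<open>T\<close> back into the position it stands for,
  whose powers enter the monomial weight.\<close>

lemma exp_poly_times_power:
  assumes "exp_poly K E g f"
  shows "exp_poly K (E + e) g (\<lambda>T. smult (of_nat (T + s) ^ e) (f T))"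
proof (induction e)
  case 0
  then show ?case using assms by simp
next
  case (Suc e)
  have "exp_poly K (Suc (E + e)) g (\<lambda>T. smult (of_nat T) (smult (of_nat (T + s) ^ e) (f T))
          + smult (of_nat s) (smult (of_nat (T + s) ^ e) (f T)))"
    by (intro exp_poly.add exp_poly_times_nat exp_poly_smult Suc exp_poly_mono[OF Suc]) auto
  moreover have "smult (of_nat T) (smult (of_nat (T + s) ^ e) (f T))
          + smult (of_nat s) (smult (of_nat (T + s) ^ e) (f T))
          = smult (of_nat (T + s) ^ Suc e) (f T)" for T
    by (simp add: algebra_simps flip: smult_add_left)
  ultimately show ?case by simp
qed

section \<open>Convolution with the powers of a linear polynomial\<close>

definition conv :: "rat poly \<Rightarrow> (nat \<Rightarrow> rat poly) \<Rightarrow> nat \<Rightarrow> rat poly" where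
  "conv w f T = (\<Sum>y<T. w ^ (T - 1 - y) * f y)"

lemma conv_0 [simp]: "conv w f 0 = 0"
  by (simp add: conv_def)

text \<open>With the value 0 at \<open>T = 0\<close>, this first-order recurrence determines the
  convolution; the closed forms are verified from it by induction.\<close>

lemma conv_Suc: "conv w f (Suc T) = w * conv w f T + f T"
proof -
  have "(\<Sum>y<T. w ^ (T - y) * f y) = (\<Sum>y<T. w * (w ^ (T - 1 - y) * f y))"
  proof (rule sum.cong[OF refl])
    fix y assume "y \<in> {..<T}"
    then have "T - y = Suc (T - 1 - y)" by auto
    then show "w ^ (T - y) * f y = w * (w ^ (T - 1 - y) * f y)" by (simp add: mult.assoc)
  qed
  then show ?thesis by (simp add: conv_def sum_distrib_left)
qed

lemma conv_add: "conv w (\<lambda>T. f T + h T) T = conv w f T + conv w h T"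
  by (simp add: conv_def sum.distrib algebra_simps)

lemma conv_smult: "conv w (\<lambda>T. smult c (f T)) T = smult c (conv w f T)"
  by (induction T) (simp_all add: conv_Suc smult_add_right)

lemma conv_mult: "conv w (\<lambda>T. f T * h) T = conv w f T * h"
  by (simp add: conv_def sum_distrib_right mult.assoc)

abbreviation binom_term :: "rat poly \<Rightarrow> nat \<Rightarrow> nat \<Rightarrow> rat poly" where
  "binom_term u r T \<equiv> smult (of_nat (T choose r)) (u ^ (T - r))"

lemma binom_term_step: "u * binom_term u r T = smult (of_nat (T choose r)) (u ^ (Suc T - r))"
  by (cases "r \<le> T") (simp_all add: Suc_diff_le binomial_eq_0 not_le)

text \<open>Equal bases resonate: the recurrence becomes Pascal's rule and the index
  \<open>r\<close> goes up by one.\<close>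

lemma conv_binom_same: "conv u (binom_term u r) T = binom_term u (Suc r) T"
proof (induction T)
  case (Suc T)
  show ?case
  proof (cases "Suc r \<le> T")
    case True
    then have "u ^ (T - r) = u * u ^ (T - Suc r)" by (metis Suc_diff_Suc Suc_le_lessD power_Suc)
    then show ?thesis by (simp add: conv_Suc Suc smult_add_left)
  next
    case False
    then have "conv u (binom_term u r) T = 0" unfolding Suc by (simp add: binomial_eq_0)
    then show ?thesis using False by (cases "r = T") (simp_all add: conv_Suc binomial_eq_0)
  qed
qed simp

text \<open>The factorization of \<open>u ^ T - w ^ T\<close> by \<open>u - w\<close>. As this
  difference is a constant, dividing by it stays within polynomials in \<open>X\<close>.\<close>

lemma conv_binom_0:
  assumes "u - w = [:d:]"
  shows "smult d (conv w (binom_term u 0) T) = u ^ T - w ^ T"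
proof (induction T)
  case (Suc T)
  have "smult d (conv w (binom_term u 0) (Suc T)) = w * smult d (conv w (binom_term u 0) T) + (u - w) * u ^ T"
    by (simp add: conv_Suc smult_add_right assms)
  also have "\<dots> = u ^ Suc T - w ^ Suc T" unfolding Suc by (simp add: algebra_simps)
  finally show ?case .
qed simp

text \<open>A partial fraction step. The generating function of \<open>binom_term u r\<close> is
  \<open>z^r / (1 - u z)^(r+1)\<close> and convolution multiplies it by
  \<open>z / (1 - w z)\<close>; the identity is
  \<open>(u - w) z = (1 - w z) - (1 - u z)\<close>.\<close>

lemma conv_binom_Suc:
  assumes "u - w = [:d:]"
  shows "smult d (conv w (binom_term u (Suc r)) T)
       = binom_term u (Suc r) T - conv w (binom_term u r) T"
proof (induction T)
  case (Suc T)
  let ?C = "\<lambda>r. conv w (binom_term u r)"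
  have "smult d (?C (Suc r) (Suc T))
      = w * smult d (?C (Suc r) T) + (u - w) * binom_term u (Suc r) T"
    by (simp add: conv_Suc smult_add_right assms mult.commute[of d])
  also have "\<dots> = u * binom_term u (Suc r) T - w * ?C r T"
    unfolding Suc by (simp only: ring_distribs)
  also have "u * binom_term u (Suc r) T = binom_term u (Suc r) (Suc T) - binom_term u r T"
    unfolding binom_term_step by (simp add: smult_add_left)
  finally show ?case by (simp add: conv_Suc)
qed simp

text \<open>Partial fractions leave mixed products \<open>w ^ T * u ^ i\<close>. Expanding
  \<open>u\<close> as \<open>w\<close> plus a constant restores a single base, with exponents at
  most \<open>i\<close>.\<close>

lemma exp_poly_const_power:
  assumes "b \<le> K" "i \<le> E"
  shows "exp_poly K E g (\<lambda>T. [:of_nat b, 1:] ^ T * [:of_nat a, 1:] ^ i)"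
proof -
  let ?w = "[:of_nat b, 1:] :: rat poly"
  let ?d = "of_nat a - of_nat b :: rat"
  have "[:of_nat a, 1:] = ?w + [:?d:]" by simp
  then have "[:of_nat a, 1:] ^ i = (\<Sum>l\<le>i. of_nat (i choose l) * ?w ^ l * [:?d:] ^ (i - l))"
    using binomial_ring[of ?w "[:?d:]" i] by simp
  also have "\<dots> = (\<Sum>l\<le>i. smult (of_nat (i choose l) * ?d ^ (i - l)) (?w ^ l))"
    by (intro sum.cong refl) (simp add: of_nat_poly poly_const_pow mult.commute)
  finally have eq: "(\<lambda>T. ?w ^ T * [:of_nat a, 1:] ^ i)
      = (\<lambda>T. \<Sum>l\<le>i. smult (of_nat (i choose l) * ?d ^ (i - l) * of_nat (T choose 0)) (?w ^ (T - 0) * ?w ^ l))"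
    by (simp add: sum_distrib_left)
  show ?thesis
    unfolding eq using assms by (intro exp_poly_sum exp_poly.single) auto
qed

text \<open>For distinct bases, partial fractions lower \<open>r\<close> step by step down to a
  difference of two powers, so \<open>g\<close> does not grow. Only the case of equal bases makes a
  convolution cost one unit of \<open>g\<close>.\<close>

lemma exp_poly_conv_single:
  assumes "a \<le> K" "b \<le> K" "a \<noteq> b" "i \<le> E" "r \<le> i + g"
  shows "exp_poly K E g
     (\<lambda>T. conv [:of_nat b, 1:] (binom_term [:of_nat a, 1:] r) T * [:of_nat a, 1:] ^ i)"
  using assms(5)
proof (induction r)
  case 0
  let ?d = "of_nat a - of_nat b :: rat"
  have d: "?d \<noteq> 0" using assms by simp
  let ?u = "[:of_nat a, 1:] :: rat poly" and ?w = "[:of_nat b, 1:] :: rat poly"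
  have "exp_poly K E g (\<lambda>T. smult (1 / ?d) (?u ^ T * ?u ^ i) + smult (- 1 / ?d) (?w ^ T * ?u ^ i))"
    using assms by (intro exp_poly.add exp_poly_smult exp_poly_const_power) auto
  moreover have "smult (1 / ?d) (?u ^ T * ?u ^ i) + smult (- 1 / ?d) (?w ^ T * ?u ^ i)
      = conv ?w (binom_term ?u 0) T * ?u ^ i" for T
  proof -
    have "?u ^ T - ?w ^ T = smult ?d (conv ?w (binom_term ?u 0) T)"
      by (rule conv_binom_0[symmetric]) simp
    then have "smult (1 / ?d) ((?u ^ T - ?w ^ T) * ?u ^ i) = conv ?w (binom_term ?u 0) T * ?u ^ i"
      using d by simp
    then show ?thesis by (simp add: algebra_simps smult_diff_right)
  qed
  ultimately show ?case by simp
next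
  case (Suc r)
  let ?d = "of_nat a - of_nat b :: rat"
  have d: "?d \<noteq> 0" using assms by simp
  let ?u = "[:of_nat a, 1:] :: rat poly" and ?w = "[:of_nat b, 1:] :: rat poly"
  have "exp_poly K E g (\<lambda>T. smult (1 / ?d * of_nat (T choose Suc r)) (?u ^ (T - Suc r) * ?u ^ i)
      + smult (- 1 / ?d) (conv ?w (binom_term ?u r) T * ?u ^ i))"
    using assms Suc.prems by (intro exp_poly.add exp_poly.single exp_poly_smult Suc.IH) auto
  moreover have "smult (1 / ?d * of_nat (T choose Suc r)) (?u ^ (T - Suc r) * ?u ^ i)
      + smult (- 1 / ?d) (conv ?w (binom_term ?u r) T * ?u ^ i)
      = conv ?w (binom_term ?u (Suc r)) T * ?u ^ i" for T
  proof -
    have "binom_term ?u (Suc r) T - conv ?w (binom_term ?u r) T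
        = smult ?d (conv ?w (binom_term ?u (Suc r)) T)"
      by (rule conv_binom_Suc[symmetric]) simp
    then have "smult (1 / ?d) ((binom_term ?u (Suc r) T - conv ?w (binom_term ?u r) T) * ?u ^ i)
        = conv ?w (binom_term ?u (Suc r)) T * ?u ^ i"
      using d by simp
    then show ?thesis by (simp add: left_diff_distrib smult_diff_right)
  qed
  ultimately show ?case by simp
qed

lemma exp_poly_conv:
  "exp_poly K E g f \<Longrightarrow> b \<le> K \<Longrightarrow> exp_poly K E (Suc g) (conv [:of_nat b, 1:] f)"
proof (induction rule: exp_poly.induct)
  case zero
  have "conv [:of_nat b, 1:] (\<lambda>_. 0) = (\<lambda>_. 0)" by (simp add: conv_def fun_eq_iff)
  then show ?case by (simp add: exp_poly.zero)
next
  case (single a i r c)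
  let ?u = "[:of_nat a, 1:] :: rat poly" and ?w = "[:of_nat b, 1:] :: rat poly"
  have eq: "(\<lambda>T. smult (c * of_nat (T choose r)) (?u ^ (T - r) * ?u ^ i))
      = (\<lambda>T. smult c (binom_term ?u r T * ?u ^ i))"
    by simp
  have "exp_poly K E (Suc g) (\<lambda>T. conv ?w (binom_term ?u r) T * ?u ^ i)"
  proof (cases "a = b")
    case True
    have "exp_poly K E (Suc g) (\<lambda>T. smult (1 * of_nat (T choose Suc r)) (?u ^ (T - Suc r) * ?u ^ i))"
      using single by (intro exp_poly.single) auto
    then show ?thesis using True by (simp add: conv_binom_same)
  next
    case False
    then show ?thesis
      using single by (intro exp_poly_mono[OF exp_poly_conv_single[of a K b i E r g]]) auto
  qed
  then have "exp_poly K E (Suc g) (\<lambda>T. smult c (conv ?w (binom_term ?u r) T * ?u ^ i))"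
    by (rule exp_poly_smult)
  then show ?case unfolding eq by (simp only: conv_smult[symmetric] conv_mult[symmetric])
next
  case (add f h)
  have "conv [:of_nat b, 1:] (\<lambda>T. f T + h T) = (\<lambda>T. conv [:of_nat b, 1:] f T + conv [:of_nat b, 1:] h T)"
    by (simp add: conv_add fun_eq_iff)
  then show ?case using exp_poly.add[OF add.IH] add.prems by simp
qed

section \<open>Shifted Bell polynomials with bounded coefficients\<close>

definition bell_sum :: "nat \<Rightarrow> nat \<Rightarrow> (int \<Rightarrow> rat poly) \<Rightarrow> nat \<Rightarrow> rat" where
  "bell_sum k N q n = (\<Sum>j=- int k..int N. poly (q j) (of_nat n) * of_nat (bell (int n + j)))"

text \<open>These are the bounds of the theorem written in terms of the shift itself. Coefficients
  outside the range are forced to be 0, so that a whole family \<open>q\<close> can be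
  unique.\<close>

definition bell_coeffs :: "nat \<Rightarrow> nat \<Rightarrow> (int \<Rightarrow> rat poly) \<Rightarrow> bool" where
  "bell_coeffs k N q \<longleftrightarrow> (\<forall>j. q j \<noteq> 0 \<longrightarrow>
     - int k \<le> j \<and> j \<le> int N \<and> int (degree (q j)) \<le> int N - j - (if j < 0 then 1 else 0))"

text \<open>The set \<open>S\<close> records for which \<open>n\<close> the formula is claimed, as
  consecutivity conditions can spoil it for small \<open>n\<close>.\<close>

definition bell_form :: "nat \<Rightarrow> nat \<Rightarrow> nat set \<Rightarrow> (nat \<Rightarrow> rat) \<Rightarrow> bool" where
  "bell_form k N S h \<longleftrightarrow> (\<exists>q. bell_coeffs k N q \<and> (\<forall>n\<in>S. h n = bell_sum k N q n))"

lemma bell_coeffs_mono: "bell_coeffs k N q \<Longrightarrow> k \<le> k' \<Longrightarrow> N \<le> N' \<Longrightarrow> bell_coeffs k' N' q"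
  unfolding bell_coeffs_def by fastforce

lemma bell_sum_extend:
  assumes "bell_coeffs k N q" "k \<le> k'" "N \<le> N'"
  shows "bell_sum k N q n = bell_sum k' N' q n"
  unfolding bell_sum_def
proof (rule sum.mono_neutral_left)
  show "\<forall>j\<in>{- int k'..int N'} - {- int k..int N}. poly (q j) (of_nat n) * of_nat (bell (int n + j)) = 0"
  proof
    fix j assume "j \<in> {- int k'..int N'} - {- int k..int N}"
    then have "q j = 0" using assms(1) by (force simp: bell_coeffs_def)
    then show "poly (q j) (of_nat n) * of_nat (bell (int n + j)) = 0" by simp
  qed
qed (use assms in auto)

lemma bell_form_mono:
  assumes "bell_form k N S h" "k \<le> k'" "N \<le> N'" "S' \<subseteq> S"
  shows "bell_form k' N' S' h"
proof -
  obtain q where q: "bell_coeffs k N q" "\<forall>n\<in>S. h n = bell_sum k N q n"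
    using assms by (auto simp: bell_form_def)
  then have "\<forall>n\<in>S'. h n = bell_sum k' N' q n"
    using assms bell_sum_extend[OF q(1) assms(2,3)] by auto
  then show ?thesis using bell_coeffs_mono[OF q(1) assms(2,3)] by (auto simp: bell_form_def)
qed

lemma bell_form_cong:
  assumes "bell_form k N S h" "\<And>n. n \<in> S \<Longrightarrow> h n = h' n"
  shows "bell_form k N S h'"
  using assms by (auto simp: bell_form_def)

lemma bell_form_0: "bell_form k N S (\<lambda>_. 0)"
  unfolding bell_form_def bell_coeffs_def bell_sum_def by (intro exI[of _ "\<lambda>_. 0"]) simp

lemma bell_form_add:
  assumes "bell_form k N S h" "bell_form k N S h'"
  shows "bell_form k N S (\<lambda>n. h n + h' n)"
proof -
  obtain q q' where q: "bell_coeffs k N q" "\<forall>n\<in>S. h n = bell_sum k N q n"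
    and q': "bell_coeffs k N q'" "\<forall>n\<in>S. h' n = bell_sum k N q' n"
    using assms by (auto simp: bell_form_def)
  have "bell_coeffs k N (\<lambda>j. q j + q' j)"
    unfolding bell_coeffs_def
  proof (intro allI impI)
    fix j assume ne: "q j + q' j \<noteq> 0"
    consider "q j = 0" "q' j \<noteq> 0" | "q' j = 0" "q j \<noteq> 0" | "q j \<noteq> 0" "q' j \<noteq> 0"
      using ne by fastforce
    then show "- int k \<le> j \<and> j \<le> int N \<and>
        int (degree (q j + q' j)) \<le> int N - j - (if j < 0 then 1 else 0)"
    proof cases
      case 3
      then show ?thesis
        using q(1) q'(1) degree_add_le_max[of "q j" "q' j"] unfolding bell_coeffs_def
        by (smt (verit) max_def of_nat_mono)
    qed (use q(1) q'(1) in \<open>auto simp: bell_coeffs_def\<close>)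
  qed
  moreover have "\<forall>n\<in>S. h n + h' n = bell_sum k N (\<lambda>j. q j + q' j) n"
    using q q' by (simp add: bell_sum_def algebra_simps sum.distrib)
  ultimately show ?thesis by (auto simp: bell_form_def)
qed

lemma bell_form_cmult:
  assumes "bell_form k N S h"
  shows "bell_form k N S (\<lambda>n. c * h n)"
proof -
  obtain q where q: "bell_coeffs k N q" "\<forall>n\<in>S. h n = bell_sum k N q n"
    using assms by (auto simp: bell_form_def)
  have "bell_coeffs k N (\<lambda>j. smult c (q j))"
    using q(1) by (auto simp: bell_coeffs_def)
  moreover have "\<forall>n\<in>S. c * h n = bell_sum k N (\<lambda>j. smult c (q j)) n"
    using q(2) by (simp add: bell_sum_def sum_distrib_left mult.assoc)
  ultimately show ?thesis by (auto simp: bell_form_def)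
qed

lemma bell_form_sum:
  "finite I \<Longrightarrow> (\<And>i. i \<in> I \<Longrightarrow> bell_form k N S (h i)) \<Longrightarrow> bell_form k N S (\<lambda>n. \<Sum>i\<in>I. h i n)"
  by (induction I rule: finite_induct) (auto intro: bell_form_0 bell_form_add)

lemma bell_form_single:
  assumes "- int k \<le> s" "s \<le> int N" "int (degree P) \<le> int N - s - (if s < 0 then 1 else 0)"
  shows "bell_form k N S (\<lambda>n. poly P (of_nat n) * of_nat (bell (int n + s)))"
proof -
  have "bell_coeffs k N (\<lambda>j. if j = s then P else 0)"
    using assms by (auto simp: bell_coeffs_def)
  moreover have "bell_sum k N (\<lambda>j. if j = s then P else 0) n
      = poly P (of_nat n) * of_nat (bell (int n + s))" for n
  proof -
    have "bell_sum k N (\<lambda>j. if j = s then P else 0) n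
        = (\<Sum>j=- int k..int N. if j = s then poly P (of_nat n) * of_nat (bell (int n + s)) else 0)"
      unfolding bell_sum_def by (intro sum.cong) auto
    then show ?thesis using assms by simp
  qed
  ultimately show ?thesis by (auto simp: bell_form_def)
qed

section \<open>From exponential polynomials to shifted Bell polynomials\<close>

lemma bell_eval_power_shift:
  "bell_eval ([:of_nat a, 1:] ^ m)
     = (\<Sum>l\<le>a. coeff (falling_poly a) l * of_nat (bell (int (m + l))) :: 'a::idom)"
proof -
  have "([:0, 1:] ^ m) \<circ>\<^sub>p [:of_nat a, 1:] = ([:of_nat a, 1:] ^ m :: 'a poly)"
    by (induction m) (simp_all add: pcompose_1 pcompose_mult pcompose_pCons)
  then have "bell_eval ([:of_nat a, 1:] ^ m :: 'a poly) = bell_eval (falling_poly a * [:0, 1:] ^ m)"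
    by (metis bell_eval_pcompose)
  also have "(falling_poly a :: 'a poly) = (\<Sum>l\<le>a. smult (coeff (falling_poly a) l) ([:0, 1:] ^ l))"
    using poly_as_sum_of_monoms[of "falling_poly a :: 'a poly"] falling_poly_monic[of a, where 'a = 'a]
    by (simp add: monom_altdef)
  finally show ?thesis
    by (simp add: sum_distrib_right bell_eval_sum bell_eval_smult bell_eval_X_power
        add.commute flip: power_add)
qed

text \<open>The binomial coefficient \<open>n - z choose r\<close> as a polynomial in
  \<open>n\<close>, correct once the subtraction is not truncated.\<close>

definition choose_poly :: "nat \<Rightarrow> nat \<Rightarrow> rat poly" where
  "choose_poly z r = smult (1 / fact r) (falling_poly r \<circ>\<^sub>p [:- of_nat z, 1:])"

lemma degree_choose_poly: "degree (choose_poly z r) \<le> r"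
  unfolding choose_poly_def
  using falling_poly_monic[of r, where 'a = rat] degree_pcompose_le[of "falling_poly r :: rat poly" "[:- of_nat z, 1:]"]
  by (intro order_trans[OF degree_smult_le]) auto

lemma poly_choose_poly:
  assumes "z \<le> n"
  shows "poly (choose_poly z r) (of_nat n) = of_nat ((n - z) choose r)"
proof -
  have "poly (falling_poly r) (of_nat n - of_nat z) = (\<Prod>l<r. of_nat n - of_nat z - of_nat l :: rat)"
    by (simp add: falling_poly_def poly_prod algebra_simps)
  then show ?thesis using assms
    by (simp add: choose_poly_def poly_pcompose binomial_gbinomial gbinomial_prod_rev of_nat_diff
        atLeast0LessThan algebra_simps)
qed

text \<open>A term with parameters \<open>a\<close>, \<open>i\<close>, \<open>r\<close> yields the
  shifts \<open>i + l - z - r\<close> for \<open>l \<le> a\<close>, with coefficients of degree at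
  most \<open>e + r\<close>. The bound \<open>r \<le> i + (k - z)\<close> keeps the shift at least
  \<open>- k\<close>.\<close>

lemma bell_form_exp_poly:
  assumes "exp_poly k E (k - z) g" "z \<le> k"
  shows "bell_form k (k + E + e) {z..} (\<lambda>n. of_nat n ^ e * bell_eval (g (n - z)))"
  using assms(1)
proof (induction rule: exp_poly.induct)
  case zero
  show ?case by (simp add: bell_form_0)
next
  case (single a i r c)
  let ?s = "\<lambda>l. int i + int l - int z - int r"
  define P where "P l = smult (c * coeff (falling_poly a) l) (monom 1 e * choose_poly z r)" for l
  have "bell_form k (k + E + e) {z..} (\<lambda>n. \<Sum>l\<le>a. poly (P l) (of_nat n) * of_nat (bell (int n + ?s l)))"
  proof (intro bell_form_sum bell_form_single)
    fix l assume l: "l \<in> {..a}"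
    then have l': "l \<le> k" using single by simp
    have "degree (P l) \<le> e + r"
      unfolding P_def
      by (intro order_trans[OF degree_smult_le] order_trans[OF degree_mult_le] add_mono degree_monom_le
          degree_choose_poly)
    \<comment> \<open>The right side without the last summand exceeds \<open>e + r\<close> by
      \<open>(k - l) + (E - i) + z\<close>. If this is 0, then \<open>z = 0\<close> and
      \<open>l = k\<close>, so \<open>r \<le> i + k\<close> makes the shift nonnegative; a negative
      shift thus leaves one unit to spare.\<close>
    then show "int (degree (P l)) \<le> int (k + E + e) - ?s l - (if ?s l < 0 then 1 else 0)"
      using single l' assms(2) by (auto simp: of_nat_diff split: if_splits)
    show "- int k \<le> ?s l" "?s l \<le> int (k + E + e)" using single l' assms(2) by linarith+
  qed simp
  then show ?case
  proof (rule bell_form_cong)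
    fix n assume n: "n \<in> {z..}"
    let ?u = "[:of_nat a, 1:] :: rat poly"
    show "(\<Sum>l\<le>a. poly (P l) (of_nat n) * of_nat (bell (int n + ?s l)))
        = of_nat n ^ e * bell_eval (smult (c * of_nat (n - z choose r)) (?u ^ (n - z - r) * ?u ^ i))"
    proof (cases "r \<le> n - z")
      case True
      have "bell_eval (?u ^ (n - z - r) * ?u ^ i)
          = (\<Sum>l\<le>a. coeff (falling_poly a) l * of_nat (bell (int (n - z - r + i + l))))"
        by (simp only: bell_eval_power_shift flip: power_add)
      also have "\<dots> = (\<Sum>l\<le>a. coeff (falling_poly a) l * of_nat (bell (int n + ?s l)))"
        using True n by (intro sum.cong refl) (simp add: algebra_simps of_nat_diff)
      finally show ?thesis
        using n by (simp add: bell_eval_smult P_def poly_monom poly_choose_poly sum_distrib_left mult_ac)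
    next
      case False
      \<comment> \<open>Here the power is truncated, but both sides are 0, so the formula is valid
        from \<open>n = z\<close> on.\<close>
      then have "(n - z choose r) = 0" by (intro binomial_eq_0) simp
      then show ?thesis using n by (simp add: P_def poly_choose_poly del: binomial_eq_0_iff)
    qed
  qed
next
  case (add f h)
  then show ?case using bell_form_add[OF add.IH] by (simp add: bell_eval_add algebra_simps)
qed

lemma bell_coeffs_unique:
  assumes "bell_coeffs k N q" "bell_coeffs k' N' q'"
    and "\<And>n. n \<ge> n0 \<Longrightarrow> bell_sum k N q n = bell_sum k' N' q' n"
  shows "q = q'"
proof
  fix j
  define K M where "K = max k k'" and "M = max N N'"
  show "q j = q' j"
  proof (cases "- int K \<le> j \<and> j \<le> int M")
    case True
    have "q j - q' j = 0"
    proof (rule shifted_bell_unique[where q = "\<lambda>j. q j - q' j" and ?n0.0 = n0])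
      fix n assume "n \<ge> n0"
      then have "bell_sum K M q n = bell_sum K M q' n"
        using assms(3)[of n] bell_sum_extend[OF assms(1), of K M] bell_sum_extend[OF assms(2), of K M]
        by (simp add: K_def M_def)
      then show "(\<Sum>j=- int K..int M. poly (q j - q' j) (of_nat n) * of_nat (bell (int n + j))) = 0"
        by (simp add: bell_sum_def algebra_simps sum_subtractf)
    qed (use True in auto)
    then show ?thesis by simp
  next
    case False
    then have "q j = 0" "q' j = 0"
      using assms unfolding bell_coeffs_def K_def M_def by force+
    then show ?thesis by simp
  qed
qed

section \<open>Chains of positions\<close>

text \<open>
  The generating weight of the sequences \<open>0 = x\<^sub>0 < x\<^sub>1 < \<dots> < x\<^sub>m = n\<close> in which the gaps listed in \<open>Z\<close>
  are empty. The sum over all sequences of length \<open>k\<close> in \<open>{1..n}\<close> is recovered by adding the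
  sentinel \<open>x\<^bsub>k+1\<^esub> = n + 1\<close>.
\<close>

fun chain :: "nat set \<Rightarrow> (nat \<Rightarrow> nat) \<Rightarrow> (nat \<Rightarrow> nat) \<Rightarrow> nat \<Rightarrow> nat \<Rightarrow> rat poly" where
  "chain Z a e 0 n = (if n = 0 then 1 else 0)"
| "chain Z a e (Suc m) n = smult (of_nat n ^ e (Suc m))
     (\<Sum>t<n. if m \<in> Z \<longrightarrow> Suc t = n then [:of_nat (a m), 1:] ^ (n - 1 - t) * chain Z a e m t else 0)"

lemma chain_1: "0 \<notin> Z \<Longrightarrow> chain Z a e (Suc 0) (Suc T)
    = smult (of_nat (T + 1) ^ e 1) ([:of_nat (a 0), 1:] ^ T)"
proof -
  assume "0 \<notin> Z"
  then have "chain Z a e (Suc 0) (Suc T) = smult (of_nat (Suc T) ^ e 1)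
     (\<Sum>t<Suc T. if t = 0 then [:of_nat (a 0), 1:] ^ T else 0)"
    unfolding chain.simps by (intro arg_cong2[where f = smult] sum.cong) auto
  also have "(\<Sum>t<Suc T. if t = 0 then [:of_nat (a 0), 1:] ^ T else 0) = ([:of_nat (a 0), 1:] ^ T :: rat poly)"
    by (subst sum.delta) auto
  finally show ?thesis by simp
qed

lemma chain_flagged:
  assumes "m \<in> Z"
  shows "chain Z a e (Suc m) (Suc n) = smult (of_nat (Suc n) ^ e (Suc m)) (chain Z a e m n)"
proof -
  have "(\<Sum>t<Suc n. if m \<in> Z \<longrightarrow> Suc t = Suc n
           then [:of_nat (a m), 1:] ^ (Suc n - 1 - t) * chain Z a e m t else 0)
      = (\<Sum>t<Suc n. if t = n then chain Z a e m n else 0)"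
    by (intro sum.cong) (use assms in auto)
  then show ?thesis by simp
qed

text \<open>There are \<open>n - 1 - t\<close> elements strictly between the positions
  \<open>t\<close> and \<open>n\<close>, each of weight \<open>X + a m\<close>. Measured from the
  start \<open>s\<close> of the support, the sum over \<open>t\<close> is a convolution.\<close>

lemma chain_unflagged:
  assumes "m \<notin> Z" "\<And>n. chain Z a e m n = (if n < s then 0 else g (n - s))"
  shows "chain Z a e (Suc m) n
       = (if n < s then 0 else smult (of_nat n ^ e (Suc m)) (conv [:of_nat (a m), 1:] g (n - s)))"
proof -
  let ?w = "[:of_nat (a m), 1:] :: rat poly"
  have "(\<Sum>t<n. if m \<in> Z \<longrightarrow> Suc t = n then ?w ^ (n - 1 - t) * chain Z a e m t else 0)
      = (\<Sum>t\<in>{s..<n}. ?w ^ (n - 1 - t) * g (t - s))"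
    using assms by (intro sum.mono_neutral_cong_right) auto
  also have "\<dots> = (\<Sum>y<n - s. ?w ^ (n - s - 1 - y) * g y)"
    by (rule sum.reindex_bij_witness[of _ "\<lambda>y. y + s" "\<lambda>t. t - s"]) (auto simp: algebra_simps)
  finally show ?thesis by (simp add: conv_def)
qed

text \<open>The smallest reachable position is \<open>Suc (z m)\<close>: one for the first mark, one
  for each empty gap. An empty gap only moves this start, any other gap after the first mark costs a
  convolution, hence \<open>g = m - z m\<close>. The exponents \<open>e i\<close> add up in
  \<open>E\<close>.\<close>

lemma chain_exp_poly:
  assumes "\<And>i. a i \<le> K" "0 \<notin> Z"
  defines "z \<equiv> \<lambda>m. card (Z \<inter> {1..m})"
  shows "\<exists>g. exp_poly K (\<Sum>i=1..Suc m. e i) (m - z m) g \<and>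
     (\<forall>n. chain Z a e (Suc m) n = (if n < Suc (z m) then 0 else g (n - Suc (z m))))"
proof (induction m)
  case 0
  let ?g = "\<lambda>T. smult (of_nat (T + 1) ^ e 1) ([:of_nat (a 0), 1:] ^ T) :: rat poly"
  have "exp_poly K 0 0 (\<lambda>T. smult (1 * of_nat (T choose 0)) ([:of_nat (a 0), 1:] ^ (T - 0) * [:of_nat (a 0), 1:] ^ 0))"
    using assms(1) by (intro exp_poly.single) auto
  then have "exp_poly K 0 0 (\<lambda>T. [:of_nat (a 0), 1:] ^ T)" by simp
  then have "exp_poly K (0 + e 1) 0 ?g" by (rule exp_poly_times_power)
  moreover have "chain Z a e (Suc 0) n = (if n < Suc (z 0) then 0 else ?g (n - Suc (z 0)))" for n
    using chain_1[OF assms(2), of a e "n - 1"] by (cases n) (auto simp: z_def)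
  ultimately show ?case by (intro exI[of _ ?g]) (auto simp: z_def)
next
  case (Suc m)
  then obtain g where g: "exp_poly K (\<Sum>i=1..Suc m. e i) (m - z m) g"
    and chain: "\<And>n. chain Z a e (Suc m) n = (if n < Suc (z m) then 0 else g (n - Suc (z m)))"
    by blast
  have zle: "z m \<le> m" unfolding z_def using card_mono[of "{1..m}" "Z \<inter> {1..m}"] by simp
  show ?case
  proof (cases "Suc m \<in> Z")
    case True
    then have "Z \<inter> {1..Suc m} = insert (Suc m) (Z \<inter> {1..m})" by auto
    then have z: "z (Suc m) = Suc (z m)" by (simp add: z_def)
    let ?g = "\<lambda>T. smult (of_nat (T + (z m + 2)) ^ e (Suc (Suc m))) (g T)"
    have "exp_poly K ((\<Sum>i=1..Suc m. e i) + e (Suc (Suc m))) (m - z m) ?g"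
      by (rule exp_poly_times_power[OF g])
    moreover have "chain Z a e (Suc (Suc m)) n
        = (if n < Suc (z (Suc m)) then 0 else ?g (n - Suc (z (Suc m))))" for n
    proof (cases n)
      case (Suc n')
      then show ?thesis unfolding Suc chain_flagged[OF True] chain z
        by (auto simp: not_less)
    qed simp
    ultimately show ?thesis unfolding z by (intro exI[of _ ?g]) simp
  next
    case False
    then have "Z \<inter> {1..Suc m} = Z \<inter> {1..m}" by (auto simp: le_Suc_eq)
    then have z: "z (Suc m) = z m" by (simp add: z_def)
    let ?g = "\<lambda>T. smult (of_nat (T + Suc (z m)) ^ e (Suc (Suc m))) (conv [:of_nat (a (Suc m)), 1:] g T)"
    have "exp_poly K ((\<Sum>i=1..Suc m. e i) + e (Suc (Suc m))) (Suc (m - z m)) ?g"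
      by (intro exp_poly_times_power exp_poly_conv g assms)
    moreover have "chain Z a e (Suc (Suc m)) n
        = (if n < Suc (z (Suc m)) then 0 else ?g (n - Suc (z (Suc m))))" for n
      unfolding chain_unflagged[OF False chain] z by simp
    ultimately show ?thesis using zle unfolding z by (intro exI[of _ ?g]) (simp add: Suc_diff_le)
  qed
qed

section \<open>Increasing sequences and their weights\<close>

definition inc_seqs :: "nat set \<Rightarrow> nat \<Rightarrow> nat \<Rightarrow> (nat \<Rightarrow> nat) set" where
  "inc_seqs Z m n = {x \<in> {1..m} \<rightarrow>\<^sub>E {1..n}. strict_mono_on {1..m} x \<and>
     (\<forall>i\<in>Z. 1 \<le> i \<and> i < m \<longrightarrow> x (Suc i) = Suc (x i))}"

definition top_pos :: "nat \<Rightarrow> (nat \<Rightarrow> nat) \<Rightarrow> nat" where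
  "top_pos m x = (if m = 0 then 0 else x m)"

text \<open>A monomial in the positions times the polynomial whose Bell value counts the partitions.
  The number of positions below \<open>y\<close> is the index of the gap holding
  \<open>y\<close>.\<close>

definition seq_weight :: "(nat \<Rightarrow> nat) \<Rightarrow> (nat \<Rightarrow> nat) \<Rightarrow> nat \<Rightarrow> nat \<Rightarrow> (nat \<Rightarrow> nat) \<Rightarrow> rat poly" where
  "seq_weight a e m n x = smult (\<Prod>i=1..m. of_nat (x i) ^ e i)
     (\<Prod>y\<in>{1..n} - x ` {1..m}. [:of_nat (a (card {i \<in> {1..m}. x i < y})), 1:])"

lemma finite_inc_seqs: "finite (inc_seqs Z m n)"
  by (rule finite_subset[of _ "{1..m} \<rightarrow>\<^sub>E {1..n}"]) (auto simp: inc_seqs_def finite_PiE)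

lemma inc_seqs_le_top:
  assumes "x \<in> inc_seqs Z m n"
  shows "i \<in> {1..m} \<Longrightarrow> x i \<le> top_pos m x" "top_pos m x \<le> n"
proof -
  show "top_pos m x \<le> n" using assms by (auto simp: inc_seqs_def top_pos_def PiE_iff)
  assume i: "i \<in> {1..m}"
  show "x i \<le> top_pos m x"
  proof (cases "i = m")
    case False
    then have "x i < x m" 
      using assms i strict_mono_onD[of "{1..m}" x i m] by (auto simp: inc_seqs_def)
    then show ?thesis using i by (auto simp: top_pos_def)
  qed (use i in \<open>auto simp: top_pos_def\<close>)
qed

lemma inc_seqs_mono: "t \<le> n \<Longrightarrow> inc_seqs Z m t \<subseteq> inc_seqs Z m n"
  by (auto simp: inc_seqs_def PiE_iff)

lemma inc_seqs_with_top:
  assumes "t \<le> n"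
  shows "{x \<in> inc_seqs Z m n. top_pos m x = t} = {x \<in> inc_seqs Z m t. top_pos m x = t}"
proof -
  have "x \<in> inc_seqs Z m t" if x: "x \<in> inc_seqs Z m n" "top_pos m x = t" for x
    using x inc_seqs_le_top(1)[OF x(1)] by (auto simp: inc_seqs_def PiE_iff)
  then show ?thesis using inc_seqs_mono[OF assms] by blast
qed

text \<open>Everything above the last position lies in gap \<open>m\<close> and contributes a pure
  power.\<close>

lemma seq_weight_top:
  assumes x: "x \<in> inc_seqs Z m n"
  shows "seq_weight a e m n x
       = [:of_nat (a m), 1:] ^ (n - top_pos m x) * seq_weight a e m (top_pos m x) x"
proof -
  let ?t = "top_pos m x"
  let ?f = "\<lambda>y. [:of_nat (a (card {i \<in> {1..m}. x i < y})), 1:] :: rat poly"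
  note le = inc_seqs_le_top[OF x]
  have split: "{1..n} - x ` {1..m} = ({1..?t} - x ` {1..m}) \<union> {?t<..n}"
    using le by fastforce
  have "(\<Prod>y\<in>{1..n} - x ` {1..m}. ?f y) = (\<Prod>y\<in>{1..?t} - x ` {1..m}. ?f y) * (\<Prod>y\<in>{?t<..n}. ?f y)"
    unfolding split by (rule prod.union_disjoint) auto
  also have "(\<Prod>y\<in>{?t<..n}. ?f y) = (\<Prod>y\<in>{?t<..n}. [:of_nat (a m), 1:])"
  proof (rule prod.cong[OF refl])
    fix y assume "y \<in> {?t<..n}"
    then have "{i \<in> {1..m}. x i < y} = {1..m}" using le(1) by fastforce
    then show "?f y = [:of_nat (a m), 1:]" by simp
  qed
  finally show ?thesis by (simp add: seq_weight_def mult.commute)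
qed

text \<open>Grouping by the last position \<open>t\<close> produces the inner sum of
  \<open>chain\<close> at \<open>Suc n\<close>; the condition \<open>Suc t = Suc n\<close> is kept
  in that shape.\<close>

lemma sum_seq_weight_by_top:
  "(\<Sum>x\<in>{x \<in> inc_seqs Z m n. m \<in> Z \<longrightarrow> top_pos m x = n}. seq_weight a e m n x)
   = (\<Sum>t<Suc n. if m \<in> Z \<longrightarrow> Suc t = Suc n then [:of_nat (a m), 1:] ^ (n - t) *
        (\<Sum>x\<in>{x \<in> inc_seqs Z m t. top_pos m x = t}. seq_weight a e m t x) else 0)"
proof -
  let ?S = "{x \<in> inc_seqs Z m n. m \<in> Z \<longrightarrow> top_pos m x = n}"
  have "sum (seq_weight a e m n) ?S
      = (\<Sum>t<Suc n. \<Sum>x\<in>{x \<in> ?S. top_pos m x = t}. seq_weight a e m n x)"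
    by (rule sum.group[symmetric])
       (auto simp: finite_inc_seqs less_Suc_eq_le dest: inc_seqs_le_top(2))
  also have "\<dots> = (\<Sum>t<Suc n. if m \<in> Z \<longrightarrow> Suc t = Suc n then [:of_nat (a m), 1:] ^ (n - t) *
        (\<Sum>x\<in>{x \<in> inc_seqs Z m t. top_pos m x = t}. seq_weight a e m t x) else 0)"
  proof (rule sum.cong[OF refl])
    fix t assume "t \<in> {..<Suc n}"
    then have t: "t \<le> n" by auto
    show "(\<Sum>x\<in>{x \<in> ?S. top_pos m x = t}. seq_weight a e m n x)
      = (if m \<in> Z \<longrightarrow> Suc t = Suc n then [:of_nat (a m), 1:] ^ (n - t) *
        (\<Sum>x\<in>{x \<in> inc_seqs Z m t. top_pos m x = t}. seq_weight a e m t x) else 0)"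
    proof (cases "m \<in> Z \<longrightarrow> Suc t = Suc n")
      case True
      then have "{x \<in> ?S. top_pos m x = t} = {x \<in> inc_seqs Z m t. top_pos m x = t}"
        using inc_seqs_with_top[OF t] by auto
      then have "(\<Sum>x\<in>{x \<in> ?S. top_pos m x = t}. seq_weight a e m n x)
          = (\<Sum>x\<in>{x \<in> inc_seqs Z m t. top_pos m x = t}. [:of_nat (a m), 1:] ^ (n - t) * seq_weight a e m t x)"
        using inc_seqs_mono[OF t, of Z m]
        by (intro sum.cong) (auto simp: seq_weight_top[of _ Z m n])
      then show ?thesis using True by (simp add: sum_distrib_left)
    next
      case False
      then have "{x \<in> ?S. top_pos m x = t} = {}" by auto
      then show ?thesis using False by (simp only: sum.empty if_False)
    qed
  qed
  finally show ?thesis .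
qed

lemma seq_weight_extend:
  assumes "x \<in> inc_seqs Z m n"
  shows "seq_weight a e (Suc m) (Suc n) (x(Suc m := Suc n))
       = smult (of_nat (Suc n) ^ e (Suc m)) (seq_weight a e m n x)"
proof -
  let ?x = "x(Suc m := Suc n)"
  have img: "?x ` {1..Suc m} = insert (Suc n) (x ` {1..m})"
    by (auto simp: image_iff le_Suc_eq)
  have dom: "{1..Suc n} - ?x ` {1..Suc m} = {1..n} - x ` {1..m}" unfolding img by auto
  have gap: "{i \<in> {1..Suc m}. ?x i < y} = {i \<in> {1..m}. x i < y}" if "y \<in> {1..n} - x ` {1..m}" for y
    using that by (auto simp: le_Suc_eq)
  have "(\<Prod>i=1..m. of_nat (?x i) ^ e i) = (\<Prod>i=1..m. of_nat (x i) ^ e i :: rat)"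
    by (rule prod.cong) auto
  then have "(\<Prod>i=1..Suc m. of_nat (?x i) ^ e i)
      = of_nat (Suc n) ^ e (Suc m) * (\<Prod>i=1..m. of_nat (x i) ^ e i :: rat)"
    by (simp add: mult.commute)
  then show ?thesis
    unfolding seq_weight_def dom smult_smult
    by (intro arg_cong2[where f = smult] prod.cong) (simp_all only: gap)
qed

text \<open>Cut off or append the final position \<open>Suc n\<close>. If gap \<open>m\<close> has
  to be empty, the position before it must be \<open>n\<close>.\<close>

lemma sum_inc_seqs_Suc:
  assumes "0 \<notin> Z"
  shows "(\<Sum>x\<in>{x \<in> inc_seqs Z (Suc m) (Suc n). x (Suc m) = Suc n}. f x)
       = (\<Sum>x\<in>{x \<in> inc_seqs Z m n. m \<in> Z \<longrightarrow> top_pos m x = n}. f (x(Suc m := Suc n)))"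
proof (rule sum.reindex_bij_witness[of _ "\<lambda>x. x(Suc m := Suc n)" "\<lambda>x. restrict x {1..m}"])
  fix x assume "x \<in> {x \<in> inc_seqs Z (Suc m) (Suc n). x (Suc m) = Suc n}"
  then have x: "x \<in> {1..Suc m} \<rightarrow>\<^sub>E {1..Suc n}" "strict_mono_on {1..Suc m} x"
    "\<And>i. i \<in> Z \<Longrightarrow> 1 \<le> i \<Longrightarrow> i < Suc m \<Longrightarrow> x (Suc i) = Suc (x i)" "x (Suc m) = Suc n"
    by (auto simp: inc_seqs_def)
  have lt: "x i < Suc n" if "1 \<le> i" "i \<le> m" for i
    using strict_mono_onD[OF x(2), of i "Suc m"] that x(4) by simp
  show eq: "(restrict x {1..m})(Suc m := Suc n) = x"
    using x(1,4) by (auto simp: fun_eq_iff PiE_iff extensional_def restrict_def)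
  show "restrict x {1..m} \<in> {x \<in> inc_seqs Z m n. m \<in> Z \<longrightarrow> top_pos m x = n}"
    using x lt assms
    by (auto simp: inc_seqs_def PiE_iff top_pos_def strict_mono_on_def less_Suc_eq_le intro!: gr0I)
  show "f ((restrict x {1..m})(Suc m := Suc n)) = f x" by (simp only: eq)
next
  fix x assume "x \<in> {x \<in> inc_seqs Z m n. m \<in> Z \<longrightarrow> top_pos m x = n}"
  then have x: "x \<in> {1..m} \<rightarrow>\<^sub>E {1..n}" "strict_mono_on {1..m} x"
    "\<And>i. i \<in> Z \<Longrightarrow> 1 \<le> i \<Longrightarrow> i < m \<Longrightarrow> x (Suc i) = Suc (x i)" "m \<in> Z \<Longrightarrow> top_pos m x = n"
    by (auto simp: inc_seqs_def)
  show "restrict (x(Suc m := Suc n)) {1..m} = x"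
    using x(1) by (auto simp: fun_eq_iff PiE_iff extensional_def restrict_def)
  have "x(Suc m := Suc n) \<in> {1..Suc m} \<rightarrow>\<^sub>E {1..Suc n}"
    using x(1) by (auto simp: PiE_iff extensional_def le_Suc_eq)
  moreover have "strict_mono_on {1..Suc m} (x(Suc m := Suc n))"
  proof (rule strict_mono_onI)
    fix i j assume ij: "i \<in> {1..Suc m}" "j \<in> {1..Suc m}" "i < j"
    then have i: "i \<in> {1..m}" by auto
    then have "x i \<le> n" using x(1) by (auto simp: PiE_iff)
    then show "(x(Suc m := Suc n)) i < (x(Suc m := Suc n)) j"
      using ij i strict_mono_onD[OF x(2), of i j] by (auto simp: le_Suc_eq)
  qed
  moreover have "(x(Suc m := Suc n)) (Suc i) = Suc ((x(Suc m := Suc n)) i)"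
    if "i \<in> Z" "1 \<le> i" "i < Suc m" for i
    using that x(3)[of i] x(4) by (auto simp: less_Suc_eq top_pos_def)
  ultimately show "x(Suc m := Suc n) \<in> {x \<in> inc_seqs Z (Suc m) (Suc n). x (Suc m) = Suc n}"
    by (auto simp: inc_seqs_def)
qed

lemma smult_sum_right: "smult c (\<Sum>i\<in>I. f i) = (\<Sum>i\<in>I. smult c (f i))"
  by (induction I rule: infinite_finite_induct) (simp_all add: smult_add_right)

lemma sum_seq_weight_eq_chain:
  assumes "0 \<notin> Z"
  shows "(\<Sum>x\<in>{x \<in> inc_seqs Z m n. top_pos m x = n}. seq_weight a e m n x) = chain Z a e m n"
proof (induction m arbitrary: n)
  case 0
  show ?case
  proof (cases "n = 0")
    case True
    have "{x \<in> inc_seqs Z 0 0. top_pos 0 x = 0} = {\<lambda>_. undefined}"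
      by (auto simp: inc_seqs_def top_pos_def strict_mono_on_def)
    then show ?thesis using True by (simp add: seq_weight_def)
  next
    case False
    then have "{x \<in> inc_seqs Z 0 n. top_pos 0 x = n} = {}" by (auto simp: top_pos_def)
    then show ?thesis using False by (simp only: sum.empty chain.simps if_False)
  qed
next
  case (Suc m)
  show ?case
  proof (cases n)
    case 0
    have "inc_seqs Z (Suc m) 0 = {}" by (auto simp: inc_seqs_def PiE_iff)
    then show ?thesis using 0 by simp
  next
    case (Suc n')
    have "(\<Sum>x\<in>{x \<in> inc_seqs Z (Suc m) (Suc n'). x (Suc m) = Suc n'}. seq_weight a e (Suc m) (Suc n') x)
        = (\<Sum>x\<in>{x \<in> inc_seqs Z m n'. m \<in> Z \<longrightarrow> top_pos m x = n'}.
            smult (of_nat (Suc n') ^ e (Suc m)) (seq_weight a e m n' x))"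
      unfolding sum_inc_seqs_Suc[OF assms]
      by (rule sum.cong[OF refl]) (use seq_weight_extend in blast)
    also have "\<dots> = smult (of_nat (Suc n') ^ e (Suc m))
        (\<Sum>x\<in>{x \<in> inc_seqs Z m n'. m \<in> Z \<longrightarrow> top_pos m x = n'}. seq_weight a e m n' x)"
      by (simp only: smult_sum_right)
    also have "\<dots> = chain Z a e (Suc m) (Suc n')"
      unfolding sum_seq_weight_by_top Suc.IH chain.simps diff_Suc_1 ..
    finally show ?thesis unfolding Suc by (simp add: top_pos_def)
  qed
qed

lemma sum_seq_weight:
  assumes "0 \<notin> Z" "k \<notin> Z" "e (Suc k) = 0"
  shows "(\<Sum>x\<in>inc_seqs Z k n. seq_weight a e k n x) = chain Z a e (Suc k) (Suc n)"
proof -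
  have "(\<Sum>x\<in>inc_seqs Z k n. seq_weight a e k n x)
      = (\<Sum>x\<in>{x \<in> inc_seqs Z k n. k \<in> Z \<longrightarrow> top_pos k x = n}. seq_weight a e k n x)"
    using assms by simp
  then show ?thesis
    unfolding sum_seq_weight_by_top sum_seq_weight_eq_chain[OF assms(1)] chain.simps
    using assms by simp
qed

lemma bell_form_seq_weight:
  assumes "Z \<subseteq> {1..<k}" "\<And>i. a i \<le> k"
  shows "bell_form k (k + (\<Sum>i=1..k. e i) + d) {card Z..}
     (\<lambda>n. of_nat n ^ d * bell_eval (\<Sum>x\<in>inc_seqs Z k n. seq_weight a e k n x))"
proof -
  \<comment> \<open>The sentinel \<open>n + 1\<close> at index \<open>Suc k\<close> gets exponent 0,
    so it does not enter the monomial.\<close>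
  define e' where "e' = e(Suc k := 0)"
  have Z: "0 \<notin> Z" "k \<notin> Z" "Z \<inter> {1..k} = Z" using assms(1) by auto
  have zk: "card Z \<le> k"
    using card_mono[OF _ assms(1)] by simp
  obtain g where g: "exp_poly k (\<Sum>i=1..Suc k. e' i) (k - card Z) g"
    and chain: "\<And>n. chain Z a e' (Suc k) n = (if n < Suc (card Z) then 0 else g (n - Suc (card Z)))"
    using chain_exp_poly[of a k Z e' k] assms(2) Z by auto
  have E: "(\<Sum>i=1..Suc k. e' i) = (\<Sum>i=1..k. e i)" 
    by (auto simp: e'_def intro!: sum.cong)
  have "bell_form k (k + (\<Sum>i=1..k. e i) + d) {card Z..} (\<lambda>n. of_nat n ^ d * bell_eval (g (n - card Z)))"
    using bell_form_exp_poly[OF g zk] unfolding E .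
  then show ?thesis
  proof (rule bell_form_cong)
    fix n assume "n \<in> {card Z..}"
    then have "g (n - card Z) = chain Z a e' (Suc k) (Suc n)" unfolding chain by auto
    also have "\<dots> = (\<Sum>x\<in>inc_seqs Z k n. seq_weight a e' k n x)"
      by (rule sum_seq_weight[symmetric]) (use Z in \<open>auto simp: e'_def\<close>)
    also have "\<dots> = (\<Sum>x\<in>inc_seqs Z k n. seq_weight a e k n x)"
      by (intro sum.cong refl) (auto simp: seq_weight_def e'_def intro!: arg_cong2[where f = smult] prod.cong)
    finally show "of_nat n ^ d * bell_eval (g (n - card Z))
        = of_nat n ^ d * bell_eval (\<Sum>x\<in>inc_seqs Z k n. seq_weight a e k n x)" by simp
  qed
qed

section \<open>Counting the partitions that contain a given occurrence\<close>

text \<open>What the first, last and arc conditions demand of the marked positions among themselves.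
  Without it nothing occurs; with it those conditions restrict only the unmarked elements.\<close>

definition pattern_feasible :: "pattern \<Rightarrow> bool" where
  "pattern_feasible p \<longleftrightarrow>
     (\<forall>i\<in>pat_first p. \<forall>j. same_block (pat_partition p) i j \<longrightarrow> i \<le> j) \<and>
     (\<forall>i\<in>pat_last p. \<forall>j. same_block (pat_partition p) i j \<longrightarrow> j \<le> i) \<and>
     (\<forall>(i, j)\<in>pat_arcs p. i < j \<and> same_block (pat_partition p) i j \<and>
        (\<forall>l. same_block (pat_partition p) i l \<and> i < l \<longrightarrow> j \<le> l))"

text \<open>The conditions involving \<open>\<pi>\<close>. Monotonicity and consecutivity concern
  \<open>x\<close> alone and are left to \<open>inc_seqs\<close>.\<close>

definition pattern_occurs :: "pattern \<Rightarrow> nat set set \<Rightarrow> (nat \<Rightarrow> nat) \<Rightarrow> bool" where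
  "pattern_occurs p \<pi> x \<longleftrightarrow>
     (\<forall>i\<in>{1..pat_length p}. \<forall>j\<in>{1..pat_length p}.
        same_block \<pi> (x i) (x j) \<longleftrightarrow> same_block (pat_partition p) i j) \<and>
     (\<forall>i\<in>pat_first p. x i \<in> First \<pi>) \<and>
     (\<forall>i\<in>pat_last p. x i \<in> Last \<pi>) \<and>
     (\<forall>(i, j)\<in>pat_arcs p. (x i, x j) \<in> Arc \<pi>)"

text \<open>Gap \<open>g\<close> lies between the marked elements number \<open>g\<close> and \<open>g + 1\<close>.\<close>

definition gap_allowed :: "pattern \<Rightarrow> nat set \<Rightarrow> nat \<Rightarrow> bool" where
  "gap_allowed p b g \<longleftrightarrow> (\<forall>i\<in>pat_first p. i \<in> b \<longrightarrow> i \<le> g) \<and> (\<forall>i\<in>pat_last p. i \<in> b \<longrightarrow> \<not> i \<le> g) \<and>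
     (\<forall>(i, j)\<in>pat_arcs p. i \<in> b \<longrightarrow> \<not> (i \<le> g \<and> \<not> j \<le> g))"

definition gap_count :: "pattern \<Rightarrow> nat \<Rightarrow> nat" where
  "gap_count p g = card {b \<in> pat_partition p. gap_allowed p b g}"

definition consec_gaps :: "pattern \<Rightarrow> nat set" where
  "consec_gaps p = (\<lambda>(i, j). min i j) ` pat_consec p"

text \<open>Strictly increasing positions can differ by 1 only at neighbouring indices.\<close>

definition consec_feasible :: "pattern \<Rightarrow> bool" where
  "consec_feasible p \<longleftrightarrow> (\<forall>(i, j)\<in>pat_consec p. j = Suc i \<or> i = Suc j)"

lemma pattern_partition:
  "is_pattern p \<Longrightarrow> partition_on {1..pat_length p} (pat_partition p)"
  by (simp add: is_pattern_def set_partitions_def)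

lemma same_block_partition:
  assumes "partition_on A P" "B \<in> P" "i \<in> B"
  shows "same_block P i j \<longleftrightarrow> j \<in> B"
  using partition_on_same[OF assms(1)] assms by (auto simp: same_block_def)

text \<open>A block is determined by its minimum, so there are at most \<open>pat_length p\<close>
  blocks. This gives the bound on the constants \<open>a\<close> in the weights.\<close>

lemma gap_count_le:
  assumes "is_pattern p"
  shows "gap_count p g \<le> pat_length p"
proof -
  let ?P = "pat_partition p"
  note P = pattern_partition[OF assms]
  have fin: "finite ?P" using finite_elements[OF _ P] by simp
  have sub: "B \<subseteq> {1..pat_length p}" "B \<noteq> {}" if "B \<in> ?P" for B
    using P that by (auto simp: partition_on_def)
  have "inj_on Min ?P"
  proof (rule inj_onI)
    fix B C assume BC: "B \<in> ?P" "C \<in> ?P" "Min B = Min C"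
    have "Min B \<in> B" "Min C \<in> C" using sub BC by (meson Min_in finite_subset finite_atLeastAtMost)+
    then show "B = C" using partition_on_same[OF P] BC by metis
  qed
  moreover have "Min ` ?P \<subseteq> {1..pat_length p}"
    using sub by (metis Min_in finite_subset finite_atLeastAtMost image_subsetI subsetD)
  ultimately have "card ?P \<le> card {1..pat_length p}" by (intro card_inj_on_le[of Min]) auto
  moreover have "gap_count p g \<le> card ?P" unfolding gap_count_def by (rule card_mono[OF fin]) auto
  ultimately show ?thesis by simp
qed

text \<open>The indices with \<open>x i < y\<close> form an initial segment of
  \<open>{1..k}\<close>, so its size tells which they are.\<close>

lemma gap_index:
  assumes "strict_mono_on {1..k} x" "i \<in> {1..k}"
  shows "i \<le> card {i \<in> {1..k}. x i < y} \<longleftrightarrow> x i < (y :: nat)"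
proof -
  have mono: "x j \<le> x l" if "j \<in> {1..k}" "l \<in> {1..k}" "j \<le> l" for j l
    using assms(1) that strict_mono_on_less_eq by blast
  show ?thesis
  proof
    assume y: "x i < y"
    have "{1..i} \<subseteq> {i \<in> {1..k}. x i < y}"
    proof
      fix j assume "j \<in> {1..i}"
      then have "j \<in> {1..k}" "j \<le> i" using assms(2) by auto
      then show "j \<in> {i \<in> {1..k}. x i < y}" using mono[of j i] assms(2) y by auto
    qed
    from card_mono[OF _ this] show "i \<le> card {i \<in> {1..k}. x i < y}" by simp
  next
    assume i: "i \<le> card {i \<in> {1..k}. x i < y}"
    show "x i < y"
    proof (rule ccontr)
      assume y: "\<not> x i < y"
      have "{i \<in> {1..k}. x i < y} \<subseteq> {1..<i}"
      proof
        fix j assume j: "j \<in> {i \<in> {1..k}. x i < y}"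
        then have "\<not> i \<le> j" using mono[of i j] assms(2) y by auto
        then show "j \<in> {1..<i}" using j by auto
      qed
      from card_mono[OF _ this] have "card {i \<in> {1..k}. x i < y} \<le> i - 1" by simp
      then show False using i assms(2) by auto
    qed
  qed
qed

text \<open>\<open>x\<close> preserves and reflects both order and blocks, so an image that is
  extremal or adjacent in its block forces the same inside the pattern.\<close>

lemma pattern_occurs_feasible:
  assumes "is_pattern p" "x \<in> {1..pat_length p} \<rightarrow>\<^sub>E {1..n}" "strict_mono_on {1..pat_length p} x"
    and "\<pi> \<in> set_partitions n" "pattern_occurs p \<pi> x"
  shows "pattern_feasible p"
proof -
  let ?k = "pat_length p"
  have less: "x i < x j \<longleftrightarrow> i < j" "x i \<le> x j \<longleftrightarrow> i \<le> j" if "i \<in> {1..?k}" "j \<in> {1..?k}" for i j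
    using assms(3) that strict_mono_on_less strict_mono_on_less_eq by blast+
  have \<pi>: "partition_on {1..n} \<pi>" using assms(4) by (simp add: set_partitions_def)
  have rng: "i \<in> {1..?k}" "j \<in> {1..?k}" if "same_block (pat_partition p) i j" for i j
    using that pattern_partition[OF assms(1)] by (auto simp: same_block_def partition_on_def)
  have sb: "same_block \<pi> (x i) (x j) \<longleftrightarrow> same_block (pat_partition p) i j"
    if "i \<in> {1..?k}" "j \<in> {1..?k}" for i j
    using assms(5) that unfolding pattern_occurs_def by blast
  have in_block: "b \<in> B" if "same_block \<pi> a b" "B \<in> \<pi>" "a \<in> B" for a b B
    using same_block_partition[OF \<pi>] that by blast
  show ?thesis
    unfolding pattern_feasible_def
  proof (intro conjI ballI allI impI)
    fix i j assume ij: "i \<in> pat_first p" "same_block (pat_partition p) i j"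
    then have "same_block \<pi> (x i) (x j)" using sb rng by blast
    moreover have "x i \<in> First \<pi>" using assms(5) ij by (auto simp: pattern_occurs_def)
    ultimately have "x i \<le> x j" using in_block unfolding First_def by blast
    then show "i \<le> j" using less(2) rng ij by blast
  next
    fix i j assume ij: "i \<in> pat_last p" "same_block (pat_partition p) i j"
    then have "same_block \<pi> (x i) (x j)" using sb rng by blast
    moreover have "x i \<in> Last \<pi>" using assms(5) ij by (auto simp: pattern_occurs_def)
    ultimately have "x j \<le> x i" using in_block unfolding Last_def by blast
    then show "j \<le> i" using less(2) rng ij by blast
  next
    fix ij assume ij: "ij \<in> pat_arcs p"
    obtain i j where [simp]: "ij = (i, j)" by (cases ij)
    have k: "i \<in> {1..?k}" "j \<in> {1..?k}" using ij assms(1) by (auto simp: is_pattern_def)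
    have "(x i, x j) \<in> Arc \<pi>" using assms(5) ij by (auto simp: pattern_occurs_def)
    then obtain B where B: "x i < x j" "B \<in> \<pi>" "x i \<in> B" "x j \<in> B" "\<forall>l\<in>B. x i < l \<longrightarrow> x j \<le> l"
      by (auto simp: Arc_def)
    have "same_block \<pi> (x i) (x j)" using B by (auto simp: same_block_def)
    then have "same_block (pat_partition p) i j" using sb k by blast
    moreover have "i < j" using less k B by blast
    moreover have "j \<le> l" if l: "same_block (pat_partition p) i l" "i < l" for l
    proof -
      have "same_block \<pi> (x i) (x l)" using sb rng l by blast
      then have "x l \<in> B" using in_block B by blast
      moreover have "x i < x l" using less(1) rng l by blast
      ultimately have "x j \<le> x l" using B by blast
      then show ?thesis using less(2) rng l k by blast
    qed
    ultimately show "case ij of (i, j) \<Rightarrow> i < j \<and> same_block (pat_partition p) i j \<and>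
        (\<forall>l. same_block (pat_partition p) i l \<and> i < l \<longrightarrow> j \<le> l)" by simp
  qed
qed

text \<open>Each block of \<open>\<pi>\<close> through a marked position is the image of a pattern
  block plus unmarked elements. Compared with marked elements, the first, last and arc conditions
  are feasibility; compared with unmarked ones, they say which gaps the block tolerates.\<close>

lemma pattern_occurs_eq_block_extensions:
  assumes p: "is_pattern p" "pattern_feasible p"
    and x: "x \<in> {1..pat_length p} \<rightarrow>\<^sub>E {1..n}" "strict_mono_on {1..pat_length p} x"
  defines "gap \<equiv> \<lambda>y. card {i \<in> {1..pat_length p}. x i < y}"
  shows "{\<pi> \<in> set_partitions n. pattern_occurs p \<pi> x}
       = block_extensions ((`) x ` pat_partition p) ({1..n} - x ` {1..pat_length p})
           (\<lambda>B. {y. gap_allowed p {i \<in> {1..pat_length p}. x i \<in> B} (gap y)})"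
    (is "?L = block_extensions ?P ?U ?A")
proof -
  let ?k = "pat_length p" and ?Q = "pat_partition p"
  note Q = pattern_partition[OF p(1)]
  have less: "x i < x j \<longleftrightarrow> i < j" "x i \<le> x j \<longleftrightarrow> i \<le> j" if "i \<in> {1..?k}" "j \<in> {1..?k}" for i j
    using x(2) that strict_mono_on_less strict_mono_on_less_eq by blast+
  have inj: "inj_on x {1..?k}" using x(2) by (rule strict_mono_on_imp_inj_on)
  have rng: "x ` {1..?k} \<subseteq> {1..n}" using x(1) by (auto simp: PiE_iff)
  have sub: "b \<subseteq> {1..?k}" "b \<noteq> {}" if "b \<in> ?Q" for b
    using Q that by (auto simp: partition_on_def)
  have pre: "{i \<in> {1..?k}. x i \<in> x ` b} = b" if "b \<in> ?Q" for b
    using sub(1)[OF that] inj_on_image_mem_iff[OF inj _ sub(1)[OF that]] by blast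
  have base: "\<Union>?P \<union> ?U = {1..n}"
  proof -
    have "\<Union>?P = x ` \<Union>?Q" by blast
    then have "\<Union>?P = x ` {1..?k}" unfolding partition_onD1[OF Q, symmetric] .
    then show ?thesis using rng by blast
  qed
  have in_k: "i \<in> {1..?k}" if "i \<in> pat_first p \<or> i \<in> pat_last p \<or> (i, j) \<in> pat_arcs p \<or> (j, i) \<in> pat_arcs p" for i j
    using that p(1) by (auto simp: is_pattern_def)
  have allowed: "gap_allowed p b (gap y) \<longleftrightarrow>
      (\<forall>i\<in>pat_first p. i \<in> b \<longrightarrow> x i < y) \<and> (\<forall>i\<in>pat_last p. i \<in> b \<longrightarrow> \<not> x i < y) \<and>
      (\<forall>(i, j)\<in>pat_arcs p. i \<in> b \<longrightarrow> \<not> (x i < y \<and> \<not> x j < y))" for b y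
  proof -
    have g: "i \<le> gap y \<longleftrightarrow> x i < y" if "i \<in> {1..?k}" for i
      unfolding gap_def by (rule gap_index[OF x(2) that])
    have "(\<forall>i\<in>pat_first p. i \<in> b \<longrightarrow> i \<le> gap y) \<longleftrightarrow> (\<forall>i\<in>pat_first p. i \<in> b \<longrightarrow> x i < y)"
      by (rule ball_cong[OF refl]) (use in_k g in blast)
    moreover have "(\<forall>i\<in>pat_last p. i \<in> b \<longrightarrow> \<not> i \<le> gap y) \<longleftrightarrow> (\<forall>i\<in>pat_last p. i \<in> b \<longrightarrow> \<not> x i < y)"
      by (rule ball_cong[OF refl]) (use in_k g in blast)
    moreover have "(\<forall>(i, j)\<in>pat_arcs p. i \<in> b \<longrightarrow> \<not> (i \<le> gap y \<and> \<not> j \<le> gap y)) \<longleftrightarrow>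
        (\<forall>(i, j)\<in>pat_arcs p. i \<in> b \<longrightarrow> \<not> (x i < y \<and> \<not> x j < y))"
    proof (rule ball_cong[OF refl], clarify)
      fix i j assume "(i, j) \<in> pat_arcs p"
      then have "i \<in> {1..?k}" "j \<in> {1..?k}" using in_k by blast+
      then show "(i \<in> b \<longrightarrow> \<not> (i \<le> gap y \<and> \<not> j \<le> gap y)) = (i \<in> b \<longrightarrow> \<not> (x i < y \<and> \<not> x j < y))"
        by (simp only: g)
    qed
    ultimately show ?thesis unfolding gap_allowed_def by simp
  qed
  show ?thesis
  proof (intro set_eqI iffI)
    fix \<pi> assume "\<pi> \<in> ?L"
    then have \<pi>: "partition_on {1..n} \<pi>" and occ: "pattern_occurs p \<pi> x"
      by (auto simp: set_partitions_def)
    have sb: "same_block \<pi> (x i) (x j) \<longleftrightarrow> same_block ?Q i j"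
      if "i \<in> {1..?k}" "j \<in> {1..?k}" for i j
      using occ that unfolding pattern_occurs_def by blast
    have "\<exists>V. V \<subseteq> ?U \<inter> ?A B \<and> B \<union> V \<in> \<pi>" if "B \<in> ?P" for B
    proof -
      obtain b where b: "b \<in> ?Q" "B = x ` b" using \<open>B \<in> ?P\<close> by blast
      obtain i0 where i0: "i0 \<in> b" using sub b by blast
      then have i0k: "i0 \<in> {1..?k}" using sub b by blast
      then have "x i0 \<in> \<Union>\<pi>" unfolding partition_onD1[OF \<pi>, symmetric] using rng by blast
      then obtain S where S: "S \<in> \<pi>" "x i0 \<in> S" by blast
      have mem: "x j \<in> S \<longleftrightarrow> j \<in> b" if "j \<in> {1..?k}" for j
        using sb[OF i0k that] same_block_partition[OF \<pi> S] same_block_partition[OF Q b(1) i0] by simp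
      have Sn: "S \<subseteq> {1..n}" using S \<pi> by (auto simp: partition_on_def)
      have bS: "x ` b \<subseteq> S" using mem sub[OF b(1)] by blast
      define V where "V = S - x ` b"
      have VU: "V \<subseteq> ?U" using Sn mem by (auto simp: V_def)
      have VA: "V \<subseteq> ?A B"
      proof
        fix y assume y: "y \<in> V"
        have yS: "y \<in> S" using y by (simp add: V_def)
        \<comment> \<open>An unmarked element is never a position, which turns the weak inequalities
          of \<open>First\<close> and \<open>Arc\<close> into strict ones.\<close>
        have ne: "y \<noteq> x i" if "i \<in> {1..?k}" for i using y VU that by blast
        have uniq: "T = S" if "T \<in> \<pi>" "x i \<in> T" "i \<in> b" for T i
          using partition_on_same[OF \<pi> that(1) S(1) that(2)] bS that(3) by blast
        have "x i < y" if i: "i \<in> pat_first p" "i \<in> b" for i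
        proof -
          have "x i \<in> First \<pi>" using occ i by (auto simp: pattern_occurs_def)
          then obtain T where "T \<in> \<pi>" "x i \<in> T" "\<forall>j\<in>T. x i \<le> j" by (auto simp: First_def)
          then have "x i \<le> y" using uniq i yS by blast
          then show ?thesis using ne[of i] in_k i by (metis le_neq_implies_less)
        qed
        moreover have "\<not> x i < y" if i: "i \<in> pat_last p" "i \<in> b" for i
        proof -
          have "x i \<in> Last \<pi>" using occ i by (auto simp: pattern_occurs_def)
          then obtain T where "T \<in> \<pi>" "x i \<in> T" "\<forall>j\<in>T. j \<le> x i" by (auto simp: Last_def)
          then have "y \<le> x i" using uniq i yS by blast
          then show ?thesis by simp
        qed
        moreover have "\<not> (x i < y \<and> \<not> x j < y)" if ij: "(i, j) \<in> pat_arcs p" "i \<in> b" for i j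
        proof -
          have "(x i, x j) \<in> Arc \<pi>" using occ ij by (auto simp: pattern_occurs_def)
          then obtain T where T: "T \<in> \<pi>" "x i \<in> T" "\<forall>l\<in>T. x i < l \<longrightarrow> x j \<le> l"
            by (auto simp: Arc_def)
          then have "x i < y \<longrightarrow> x j \<le> y" using uniq ij yS by blast
          moreover have "y \<noteq> x j" using ne in_k ij by blast
          ultimately show ?thesis by auto
        qed
        ultimately have "gap_allowed p b (gap y)" unfolding allowed by blast
        then show "y \<in> ?A B" using pre[OF b(1)] b(2) by simp
      qed
      have "B \<union> V = S" using bS b(2) by (auto simp: V_def)
      then have "B \<union> V \<in> \<pi>" using S(1) by simp
      then show ?thesis by (intro exI[of _ V] conjI Int_greatest VU VA)
    qed
    then show "\<pi> \<in> block_extensions ?P ?U ?A"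
      using \<pi> unfolding block_extensions_def base by simp
  next
    fix \<pi> assume "\<pi> \<in> block_extensions ?P ?U ?A"
    then have \<pi>: "partition_on {1..n} \<pi>" and ext: "\<forall>B\<in>?P. \<exists>V. V \<subseteq> ?U \<inter> ?A B \<and> B \<union> V \<in> \<pi>"
      unfolding block_extensions_def base by simp_all
    \<comment> \<open>Pairs the pattern block of \<open>i\<close> with the block of
      \<open>\<pi>\<close> through \<open>x i\<close>. The cases that follow treat marked elements
      of \<open>S\<close> by feasibility and unmarked ones by \<open>gap_allowed\<close>.\<close>
    have block: "\<exists>b S. b \<in> ?Q \<and> i \<in> b \<and> S \<in> \<pi> \<and> x i \<in> S \<and> (\<forall>j\<in>{1..?k}. x j \<in> S \<longleftrightarrow> j \<in> b) \<and>
        (\<forall>y\<in>S. y \<in> x ` b \<or> gap_allowed p b (gap y))" if "i \<in> {1..?k}" for i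
    proof -
      have "i \<in> \<Union>?Q" unfolding partition_onD1[OF Q, symmetric] by (rule that)
      then obtain b where b: "b \<in> ?Q" "i \<in> b" by blast
      obtain V where V: "V \<subseteq> ?U \<inter> ?A (x ` b)" "x ` b \<union> V \<in> \<pi>"
        using bspec[OF ext, of "x ` b"] b by auto
      have mem: "x j \<in> x ` b \<union> V \<longleftrightarrow> j \<in> b" if j: "j \<in> {1..?k}" for j
      proof -
        have "x j \<notin> V" using V j by blast
        moreover have "x j \<in> x ` b \<longleftrightarrow> j \<in> b" using pre[OF b(1)] j by blast
        ultimately show ?thesis by simp
      qed
      have al: "\<forall>y\<in>x ` b \<union> V. y \<in> x ` b \<or> gap_allowed p b (gap y)"
        using V(1) unfolding pre[OF b(1)] by blast
      show ?thesis
        by (intro exI[of _ b] exI[of _ "x ` b \<union> V"] conjI ballI b V(2) mem al) (use b in blast)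
    qed
    have "pattern_occurs p \<pi> x"
      unfolding pattern_occurs_def
    proof (intro conjI ballI)
      fix i j assume ij: "i \<in> {1..?k}" "j \<in> {1..?k}"
      obtain b S where "b \<in> ?Q" "i \<in> b" "S \<in> \<pi>" "x i \<in> S" "\<forall>j\<in>{1..?k}. x j \<in> S \<longleftrightarrow> j \<in> b"
        using block[OF ij(1)] by blast
      then show "same_block \<pi> (x i) (x j) \<longleftrightarrow> same_block ?Q i j"
        using same_block_partition[OF \<pi>, of S "x i" "x j"] same_block_partition[OF Q, of b i j] ij by simp
    next
      fix i assume i: "i \<in> pat_first p"
      then have ik: "i \<in> {1..?k}" using in_k by blast
      obtain b S where S: "b \<in> ?Q" "i \<in> b" "S \<in> \<pi>" "x i \<in> S" "\<forall>y\<in>S. y \<in> x ` b \<or> gap_allowed p b (gap y)"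
        using block[OF ik] by blast
      have "x i \<le> y" if y: "y \<in> S" for y
      proof (cases "y \<in> x ` b")
        case True
        then obtain j where j: "j \<in> b" "y = x j" by blast
        then have "same_block ?Q i j" using S by (auto simp: same_block_def)
        then have "i \<le> j" using p(2) i unfolding pattern_feasible_def by blast
        then show ?thesis using less(2)[OF ik, of j] j sub[OF S(1)] by blast
      next
        case False
        then have "gap_allowed p b (gap y)" using S(5) y by blast
        then have "x i < y" using i S(2) unfolding allowed by blast
        then show ?thesis by simp
      qed
      then show "x i \<in> First \<pi>" using S by (auto simp: First_def)
    next
      fix i assume i: "i \<in> pat_last p"
      then have ik: "i \<in> {1..?k}" using in_k by blast
      obtain b S where S: "b \<in> ?Q" "i \<in> b" "S \<in> \<pi>" "x i \<in> S" "\<forall>y\<in>S. y \<in> x ` b \<or> gap_allowed p b (gap y)"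
        using block[OF ik] by blast
      have "y \<le> x i" if y: "y \<in> S" for y
      proof (cases "y \<in> x ` b")
        case True
        then obtain j where j: "j \<in> b" "y = x j" by blast
        then have "same_block ?Q i j" using S by (auto simp: same_block_def)
        then have "j \<le> i" using p(2) i unfolding pattern_feasible_def by blast
        then show ?thesis using less(2)[OF _ ik, of j] j sub[OF S(1)] by blast
      next
        case False
        then have "gap_allowed p b (gap y)" using S(5) y by blast
        then have "\<not> x i < y" using i S(2) unfolding allowed by blast
        then show ?thesis by simp
      qed
      then show "x i \<in> Last \<pi>" using S by (auto simp: Last_def)
    next
      fix ij assume ij: "ij \<in> pat_arcs p"
      obtain i j where e: "ij = (i, j)" by (cases ij)
      have ik: "i \<in> {1..?k}" "j \<in> {1..?k}" using in_k ij e by blast+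
      have feas: "i < j" "same_block ?Q i j" "\<And>l. same_block ?Q i l \<Longrightarrow> i < l \<Longrightarrow> j \<le> l"
        using p(2) ij e unfolding pattern_feasible_def by blast+
      obtain b S where S: "b \<in> ?Q" "i \<in> b" "S \<in> \<pi>" "x i \<in> S" "\<forall>y\<in>S. y \<in> x ` b \<or> gap_allowed p b (gap y)"
        "\<forall>j\<in>{1..?k}. x j \<in> S \<longleftrightarrow> j \<in> b"
        using block[OF ik(1)] by blast
      have "j \<in> b" using same_block_partition[OF Q S(1,2)] feas(2) by simp
      then have "x j \<in> S" using S(6) ik by blast
      moreover have "x j \<le> y" if y: "y \<in> S" "x i < y" for y
      proof (cases "y \<in> x ` b")
        case True
        then obtain l where l: "l \<in> b" "y = x l" by blast
        then have lk: "l \<in> {1..?k}" using sub[OF S(1)] by blast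
        have "same_block ?Q i l" using S l by (auto simp: same_block_def)
        moreover have "i < l" using less(1)[OF ik(1) lk] y l by simp
        ultimately have "j \<le> l" by (rule feas(3))
        then show ?thesis using less(2)[OF ik(2) lk] l by simp
      next
        case False
        then have "gap_allowed p b (gap y)" using S(5) y by blast
        then have "\<not> (x i < y \<and> \<not> x j < y)" using ij e S(2) unfolding allowed by blast
        then show ?thesis using y by simp
      qed
      moreover have "x i < x j" using less(1)[OF ik] feas(1) by simp
      ultimately have "(x i, x j) \<in> Arc \<pi>" using S by (auto simp: Arc_def)
      then show "case ij of (i, j) \<Rightarrow> (x i, x j) \<in> Arc \<pi>" using e by simp
    qed
    then show "\<pi> \<in> ?L" using \<pi> by (simp add: set_partitions_def)
  qed
qed

lemma card_pattern_occurs: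
  assumes p: "is_pattern p" "pattern_feasible p"
    and x: "x \<in> {1..pat_length p} \<rightarrow>\<^sub>E {1..n}" "strict_mono_on {1..pat_length p} x"
  shows "of_nat (card {\<pi> \<in> set_partitions n. pattern_occurs p \<pi> x})
       = bell_eval (\<Prod>y\<in>{1..n} - x ` {1..pat_length p}.
           [:of_nat (gap_count p (card {i \<in> {1..pat_length p}. x i < y})), 1:] :: rat poly)"
proof -
  let ?k = "pat_length p" and ?Q = "pat_partition p"
  let ?gap = "\<lambda>y. card {i \<in> {1..?k}. x i < y}"
  let ?A = "\<lambda>B. {y. gap_allowed p {i \<in> {1..?k}. x i \<in> B} (?gap y)}"
  note Q = pattern_partition[OF p(1)]
  have inj: "inj_on x {1..?k}" using x(2) by (rule strict_mono_on_imp_inj_on)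
  have sub: "b \<subseteq> {1..?k}" if "b \<in> ?Q" for b
    using Q that by (auto simp: partition_on_def)
  have fin: "finite ?Q" using finite_elements[OF _ Q] by simp
  have UP: "\<Union>((`) x ` ?Q) = x ` {1..?k}" using Q by (auto simp: partition_on_def)
  have part: "partition_on (x ` {1..?k}) ((`) x ` ?Q - {{}})"
    by (rule partition_on_inj_image[OF Q inj])
  have ne: "{} \<notin> (`) x ` ?Q" using Q by (auto simp: partition_on_def)
  then have dj: "disjoint ((`) x ` ?Q)" using part by (simp add: partition_on_def)
  have pre: "{i \<in> {1..?k}. x i \<in> x ` b} = b" if "b \<in> ?Q" for b
    using sub[OF that] inj_on_image_mem_iff[OF inj _ sub[OF that]] by blast
  have count: "card {B \<in> (`) x ` ?Q. y \<in> ?A B} = gap_count p (?gap y)" for y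
  proof -
    have "{B \<in> (`) x ` ?Q. y \<in> ?A B} = (`) x ` {b \<in> ?Q. gap_allowed p b (?gap y)}"
    proof -
      have "y \<in> ?A (x ` b) \<longleftrightarrow> gap_allowed p b (?gap y)" if "b \<in> ?Q" for b
        unfolding pre[OF that] by simp
      then show ?thesis by blast
    qed
    moreover have "inj_on ((`) x) {b \<in> ?Q. gap_allowed p b (?gap y)}"
    proof (rule inj_onI)
      fix b c assume bc: "b \<in> {b \<in> ?Q. gap_allowed p b (?gap y)}"
        "c \<in> {b \<in> ?Q. gap_allowed p b (?gap y)}" "x ` b = x ` c"
      have "b = {i \<in> {1..?k}. x i \<in> x ` b}" by (rule pre[symmetric]) (use bc in simp)
      also have "\<dots> = c" unfolding bc(3) by (rule pre) (use bc in simp)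
      finally show "b = c" .
    qed
    ultimately show ?thesis by (simp only: card_image gap_count_def)
  qed
  have "of_nat (card (block_extensions ((`) x ` ?Q) ({1..n} - x ` {1..?k}) ?A))
      = bell_eval (\<Prod>y\<in>{1..n} - x ` {1..?k}. [:of_nat (card {B \<in> (`) x ` ?Q. y \<in> ?A B}), 1:] :: rat poly)"
  proof (rule card_block_extensions)
    show "finite ((`) x ` ?Q)" using fin by (rule finite_imageI)
    show "finite (\<Union> ((`) x ` ?Q))" "({1..n} - x ` {1..?k}) \<inter> \<Union> ((`) x ` ?Q) = {}"
      unfolding UP by blast+
  qed (use dj ne in simp_all)
  then show ?thesis
    unfolding pattern_occurs_eq_block_extensions[OF assms] count .
qed

section \<open>Moments of statistics\<close>

lemma consec_gaps_subset:
  assumes "is_pattern p" "consec_feasible p"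
  shows "consec_gaps p \<subseteq> {1..<pat_length p}"
  using assms by (fastforce simp: consec_gaps_def consec_feasible_def is_pattern_def min_def)

text \<open>A feasible condition is the pair \<open>{m, Suc m}\<close> around its gap
  \<open>m\<close>, whichever way it is ordered, so distinct conditions correspond to distinct
  gaps.\<close>

lemma card_consec_gaps:
  assumes "consec_feasible p"
  shows "card (consec_gaps p) = num_consec p"
proof -
  let ?D = "(\<lambda>(i, j). {i, j}) ` pat_consec p"
  have form: "(case q of (i, j) \<Rightarrow> {i, j}) = {case q of (i, j) \<Rightarrow> min i j, Suc (case q of (i, j) \<Rightarrow> min i j)}"
    if "q \<in> pat_consec p" for q
    using assms that by (fastforce simp: consec_feasible_def min_def)
  then have D: "?D = (\<lambda>m. {m, Suc m}) ` consec_gaps p"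
    unfolding consec_gaps_def image_image by (rule image_cong[OF refl])
  have "inj_on (\<lambda>m. {m, Suc m}) (consec_gaps p)"
    by (rule inj_onI) (auto simp: doubleton_eq_iff)
  then show ?thesis unfolding num_consec_def D by (simp add: card_image)
qed

lemma strict_mono_on_gap:
  assumes "strict_mono_on {1..k} x" "i \<in> {1..k}" "j \<in> {1..k}" "Suc i < j"
  shows "x j \<ge> x i + (2::nat)"
proof -
  have "x i < x (Suc i)" "x (Suc i) < x j" using assms by (auto intro!: strict_mono_onD[OF assms(1)])
  then show ?thesis by linarith
qed

lemma consec_condition:
  assumes p: "is_pattern p" "consec_feasible p" and x: "strict_mono_on {1..pat_length p} x"
  shows "(\<forall>(i, j)\<in>pat_consec p. \<bar>int (x i) - int (x j)\<bar> = 1) \<longleftrightarrow>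
     (\<forall>i\<in>consec_gaps p. 1 \<le> i \<and> i < pat_length p \<longrightarrow> x (Suc i) = Suc (x i))"
proof -
  have "(case q of (i, j) \<Rightarrow> \<bar>int (x i) - int (x j)\<bar> = 1) \<longleftrightarrow>
      (let m = (case q of (i, j) \<Rightarrow> min i j) in x (Suc m) = Suc (x m))" if q: "q \<in> pat_consec p" for q
  proof -
    obtain i j where e: "q = (i, j)" by (cases q)
    have k: "i \<in> {1..pat_length p}" "j \<in> {1..pat_length p}" using q e p(1) by (auto simp: is_pattern_def)
    have "j = Suc i \<or> i = Suc j" using q e p(2) by (auto simp: consec_feasible_def)
    then show ?thesis
    proof
      assume "j = Suc i"
      moreover from this have "x i < x j" using strict_mono_onD[OF x k] by simp
      ultimately show ?thesis using e by (auto simp: min_def Let_def)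
    next
      assume "i = Suc j"
      moreover from this have "x j < x i" using strict_mono_onD[OF x k(2,1)] by simp
      ultimately show ?thesis using e by (auto simp: min_def Let_def)
    qed
  qed
  then have "(\<forall>(i, j)\<in>pat_consec p. \<bar>int (x i) - int (x j)\<bar> = 1) \<longleftrightarrow>
      (\<forall>q\<in>pat_consec p. let m = (case q of (i, j) \<Rightarrow> min i j) in x (Suc m) = Suc (x m))"
    by (rule ball_cong[OF refl])
  also have "\<dots> \<longleftrightarrow> (\<forall>m\<in>consec_gaps p. x (Suc m) = Suc (x m))"
    by (simp add: consec_gaps_def Let_def)
  also have "\<dots> \<longleftrightarrow> (\<forall>i\<in>consec_gaps p. 1 \<le> i \<and> i < pat_length p \<longrightarrow> x (Suc i) = Suc (x i))"
    using consec_gaps_subset[OF p] by (intro ball_cong) auto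
  finally show ?thesis .
qed

lemma occurrences_iff:
  assumes "is_pattern p" "consec_feasible p"
  shows "x \<in> occurrences p n \<pi> \<longleftrightarrow>
     x \<in> inc_seqs (consec_gaps p) (pat_length p) n \<and> pattern_occurs p \<pi> x"
  using consec_condition[OF assms, of x]
  unfolding occurrences_def inc_seqs_def pattern_occurs_def by blast

lemma occurrences_infeasible:
  assumes "is_pattern p" "\<pi> \<in> set_partitions n" "\<not> (pattern_feasible p \<and> consec_feasible p)"
  shows "occurrences p n \<pi> = {}"
proof (rule ccontr)
  assume "occurrences p n \<pi> \<noteq> {}"
  then obtain x where x: "x \<in> occurrences p n \<pi>" by blast
  have mono: "strict_mono_on {1..pat_length p} x" using x by (simp add: occurrences_def)
  have "pattern_feasible p"
    by (rule pattern_occurs_feasible[OF assms(1) _ mono assms(2)])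
       (use x in \<open>auto simp: occurrences_def pattern_occurs_def\<close>)
  moreover have "consec_feasible p"
    unfolding consec_feasible_def
  proof clarify
    fix i j assume ij: "(i, j) \<in> pat_consec p" "i \<noteq> Suc j"
    have k: "i \<in> {1..pat_length p}" "j \<in> {1..pat_length p}"
      using ij assms(1) by (auto simp: is_pattern_def)
    have d: "\<bar>int (x i) - int (x j)\<bar> = 1" using x ij by (auto simp: occurrences_def)
    show "j = Suc i"
    proof (rule ccontr)
      assume "j \<noteq> Suc i"
      then consider "i = j" | "Suc i < j" | "Suc j < i" using ij(2) by linarith
      then show False
        using d strict_mono_on_gap[OF mono k] strict_mono_on_gap[OF mono k(2,1)] by cases auto
    qed
  qed
  ultimately show False using assms(3) by blast
qed

section \<open>Moments of simple statistics\<close>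

lemma finite_set_partitions: "finite (set_partitions n)"
  unfolding set_partitions_def by (rule finitely_many_partition_on) simp

text \<open>Double counting: exchange the sums and, for each \<open>x\<close>, count the partitions
  in which it occurs.\<close>

lemma sum_occurrences:
  assumes p: "is_pattern p" "pattern_feasible p" "consec_feasible p"
  shows "(\<Sum>\<pi>\<in>set_partitions n. \<Sum>x\<in>occurrences p n \<pi>. \<Prod>i=1..pat_length p. of_nat (x i) ^ e i)
       = bell_eval (\<Sum>x\<in>inc_seqs (consec_gaps p) (pat_length p) n. seq_weight (gap_count p) e (pat_length p) n x)"
proof -
  let ?k = "pat_length p"
  let ?I = "inc_seqs (consec_gaps p) ?k n"
  let ?m = "\<lambda>x. \<Prod>i=1..?k. of_nat (x i) ^ e i :: rat"
  have occ: "occurrences p n \<pi> = {x \<in> ?I. pattern_occurs p \<pi> x}" for \<pi>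
    using occurrences_iff[OF p(1,3)] by blast
  have "(\<Sum>\<pi>\<in>set_partitions n. \<Sum>x\<in>occurrences p n \<pi>. ?m x)
      = (\<Sum>x\<in>?I. \<Sum>\<pi>\<in>{\<pi> \<in> set_partitions n. pattern_occurs p \<pi> x}. ?m x)"
    unfolding occ by (rule sum.swap_restrict[OF finite_set_partitions finite_inc_seqs])
  also have "\<dots> = (\<Sum>x\<in>?I. bell_eval (seq_weight (gap_count p) e ?k n x))"
  proof (rule sum.cong[OF refl])
    fix x assume "x \<in> ?I"
    then have "x \<in> {1..?k} \<rightarrow>\<^sub>E {1..n}" "strict_mono_on {1..?k} x" by (auto simp: inc_seqs_def)
    from card_pattern_occurs[OF p(1,2) this]
    show "(\<Sum>\<pi>\<in>{\<pi> \<in> set_partitions n. pattern_occurs p \<pi> x}. ?m x)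
        = bell_eval (seq_weight (gap_count p) e ?k n x)"
      by (simp add: seq_weight_def bell_eval_smult mult.commute)
  qed
  finally show ?thesis by (simp add: bell_eval_sum)
qed

text \<open>Variable 0 stands for \<open>n\<close>, which is constant in the sum over occurrences
  and can be taken out.\<close>

lemma monomial_split:
  fixes e :: "nat \<Rightarrow>\<^sub>0 nat"
  assumes "Poly_Mapping.keys e \<subseteq> {0..k}"
  shows "(\<Prod>i\<in>Poly_Mapping.keys e. (if i = 0 then n else x i) ^ Poly_Mapping.lookup e i)
       = n ^ Poly_Mapping.lookup e 0 * (\<Prod>i=1..k. x i ^ Poly_Mapping.lookup e i :: 'a::comm_semiring_1)"
    and "(\<Sum>i\<in>Poly_Mapping.keys e. Poly_Mapping.lookup e i)
       = Poly_Mapping.lookup e 0 + (\<Sum>i=1..k. Poly_Mapping.lookup e i)"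
proof -
  have ins: "{0..k} = insert 0 {1..k}" by auto
  have "(\<Prod>i\<in>Poly_Mapping.keys e. (if i = 0 then n else x i) ^ Poly_Mapping.lookup e i)
      = (\<Prod>i\<in>{0..k}. (if i = 0 then n else x i) ^ Poly_Mapping.lookup e i)"
    by (rule prod.mono_neutral_left) (use assms in \<open>auto simp: in_keys_iff\<close>)
  also have "\<dots> = n ^ Poly_Mapping.lookup e 0 * (\<Prod>i=1..k. x i ^ Poly_Mapping.lookup e i)"
    unfolding ins by (subst prod.insert) (auto intro!: arg_cong2[where f = "(*)"] prod.cong)
  finally show "(\<Prod>i\<in>Poly_Mapping.keys e. (if i = 0 then n else x i) ^ Poly_Mapping.lookup e i)
       = n ^ Poly_Mapping.lookup e 0 * (\<Prod>i=1..k. x i ^ Poly_Mapping.lookup e i)" .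
  have "(\<Sum>i\<in>Poly_Mapping.keys e. Poly_Mapping.lookup e i) = (\<Sum>i\<in>{0..k}. Poly_Mapping.lookup e i)"
    by (rule sum.mono_neutral_left) (use assms in \<open>auto simp: in_keys_iff\<close>)
  then show "(\<Sum>i\<in>Poly_Mapping.keys e. Poly_Mapping.lookup e i)
       = Poly_Mapping.lookup e 0 + (\<Sum>i=1..k. Poly_Mapping.lookup e i)"
    unfolding ins by simp
qed

lemma mpoly_degree_ge:
  assumes "e \<in> Poly_Mapping.keys Q"
  shows "(\<Sum>i\<in>Poly_Mapping.keys e. Poly_Mapping.lookup e i) \<le> mpoly_degree Q"
  unfolding mpoly_degree_def by (rule Max_ge) (use assms in auto)

lemma simple_stat_monomials:
  assumes "mpoly_vars Q \<subseteq> {0..pat_length p}"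
  shows "simple_stat p Q n \<pi> = (\<Sum>e\<in>Poly_Mapping.keys Q. of_int (Poly_Mapping.lookup Q e) *
     (of_nat n ^ Poly_Mapping.lookup e 0 *
       (\<Sum>x\<in>occurrences p n \<pi>. \<Prod>i=1..pat_length p. of_nat (x i) ^ Poly_Mapping.lookup e i)))"
proof -
  have keys: "Poly_Mapping.keys e \<subseteq> {0..pat_length p}" if "e \<in> Poly_Mapping.keys Q" for e
    using assms that by (auto simp: mpoly_vars_def)
  have "mpoly_eval (\<lambda>i. if i = 0 then int n else int (x i)) Q
      = (\<Sum>e\<in>Poly_Mapping.keys Q. Poly_Mapping.lookup Q e *
          (int n ^ Poly_Mapping.lookup e 0 * (\<Prod>i=1..pat_length p. int (x i) ^ Poly_Mapping.lookup e i)))" for x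
    unfolding mpoly_eval_def by (rule sum.cong[OF refl]) (simp only: monomial_split(1)[OF keys])
  then have "simple_stat p Q n \<pi> = (\<Sum>x\<in>occurrences p n \<pi>. \<Sum>e\<in>Poly_Mapping.keys Q.
      of_int (Poly_Mapping.lookup Q e) *
      (of_nat n ^ Poly_Mapping.lookup e 0 * (\<Prod>i=1..pat_length p. of_nat (x i) ^ Poly_Mapping.lookup e i)))"
    by (simp add: simple_stat_def)
  then show ?thesis by (subst (asm) sum.swap) (simp add: sum_distrib_left)
qed

lemma bell_form_simple_stat:
  assumes p: "is_pattern p" and Q: "mpoly_vars Q \<subseteq> {0..pat_length p}"
  shows "bell_form (pat_length p) (pat_length p + mpoly_degree Q) {num_consec p..}
           (moment (simple_stat p Q))"
proof (cases "pattern_feasible p \<and> consec_feasible p")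
  case False
  show ?thesis
  proof (rule bell_form_cong[OF bell_form_0])
    fix n
    show "0 = moment (simple_stat p Q) n"
      unfolding moment_def simple_stat_def using occurrences_infeasible[OF p _ False] by simp
  qed
next
  case True
  let ?k = "pat_length p"
  let ?S = "\<lambda>e n. \<Sum>x\<in>inc_seqs (consec_gaps p) ?k n. seq_weight (gap_count p) (Poly_Mapping.lookup e) ?k n x"
  have form: "bell_form ?k (?k + mpoly_degree Q) {num_consec p..}
      (\<lambda>n. of_nat n ^ Poly_Mapping.lookup e 0 * bell_eval (?S e n))"
    if "e \<in> Poly_Mapping.keys Q" for e
  proof -
    have "Poly_Mapping.keys e \<subseteq> {0..?k}" using Q that by (auto simp: mpoly_vars_def)
    from monomial_split(2)[OF this] mpoly_degree_ge[OF that]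
    have deg: "(\<Sum>i=1..?k. Poly_Mapping.lookup e i) + Poly_Mapping.lookup e 0 \<le> mpoly_degree Q" by simp
    have "bell_form ?k (?k + (\<Sum>i=1..?k. Poly_Mapping.lookup e i) + Poly_Mapping.lookup e 0)
        {card (consec_gaps p)..} (\<lambda>n. of_nat n ^ Poly_Mapping.lookup e 0 * bell_eval (?S e n))"
      by (rule bell_form_seq_weight) (use consec_gaps_subset gap_count_le p True in auto)
    then show ?thesis by (rule bell_form_mono) (use deg True card_consec_gaps in auto)
  qed
  have "bell_form ?k (?k + mpoly_degree Q) {num_consec p..}
     (\<lambda>n. \<Sum>e\<in>Poly_Mapping.keys Q. of_int (Poly_Mapping.lookup Q e) *
        (of_nat n ^ Poly_Mapping.lookup e 0 * bell_eval (?S e n)))"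
    by (intro bell_form_sum bell_form_cmult form) auto
  then show ?thesis
  proof (rule bell_form_cong)
    fix n
    have "moment (simple_stat p Q) n = (\<Sum>e\<in>Poly_Mapping.keys Q. of_int (Poly_Mapping.lookup Q e) *
        (of_nat n ^ Poly_Mapping.lookup e 0 * (\<Sum>\<pi>\<in>set_partitions n.
          \<Sum>x\<in>occurrences p n \<pi>. \<Prod>i=1..?k. of_nat (x i) ^ Poly_Mapping.lookup e i)))"
      unfolding moment_def simple_stat_monomials[OF Q]
      by (subst sum.swap) (simp add: sum_distrib_left)
    then show "(\<Sum>e\<in>Poly_Mapping.keys Q. of_int (Poly_Mapping.lookup Q e) *
        (of_nat n ^ Poly_Mapping.lookup e 0 * bell_eval (?S e n))) = moment (simple_stat p Q) n"
      using sum_occurrences[OF p] True by simp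
  qed
qed

section \<open>Linear combinations and the comparison of representations\<close>

lemma bell_form_rep:
  assumes "\<forall>(c, p, Q)\<in>set r. is_pattern p \<and> mpoly_vars Q \<subseteq> {0..pat_length p}"
    and "\<And>c p Q. (c, p, Q) \<in> set r \<Longrightarrow> pat_length p \<le> k \<and> pat_length p + mpoly_degree Q \<le> N"
  shows "bell_form k N {n. \<forall>(c, p, Q)\<in>set r. num_consec p \<le> n}
           (\<lambda>n. \<Sum>(c, p, Q)\<leftarrow>r. c * moment (simple_stat p Q) n)"
  using assms
proof (induction r)
  case Nil
  show ?case by (simp add: bell_form_0)
next
  case (Cons t r)
  obtain c p Q where t: "t = (c, p, Q)" by (cases t)
  let ?S = "\<lambda>r. {n. \<forall>(c, p, Q)\<in>set r. num_consec p \<le> n}"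
  have "bell_form k N (?S (t # r)) (\<lambda>n. c * moment (simple_stat p Q) n)"
    by (rule bell_form_cmult, rule bell_form_mono[OF bell_form_simple_stat])
       (use Cons.prems(1) Cons.prems(2)[of c p Q] t in auto)
  moreover have "bell_form k N (?S r) (\<lambda>n. \<Sum>(c, p, Q)\<leftarrow>r. c * moment (simple_stat p Q) n)"
    by (rule Cons.IH) (use Cons.prems in auto)
  then have "bell_form k N (?S (t # r)) (\<lambda>n. \<Sum>(c, p, Q)\<leftarrow>r. c * moment (simple_stat p Q) n)"
    by (rule bell_form_mono) auto
  ultimately have "bell_form k N (?S (t # r)) (\<lambda>n. c * moment (simple_stat p Q) n
      + (\<Sum>(c, p, Q)\<leftarrow>r. c * moment (simple_stat p Q) n))"
    by (rule bell_form_add)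
  then show ?case using t by simp
qed

lemma moment_represents:
  assumes "represents r f"
  shows "moment f n = (\<Sum>(c, p, Q)\<leftarrow>r. c * moment (simple_stat p Q) n)"
proof -
  have "moment f n = (\<Sum>\<pi>\<in>set_partitions n. \<Sum>(c, p, Q)\<leftarrow>r. c * simple_stat p Q n \<pi>)"
    unfolding moment_def using assms by (intro sum.cong) (auto simp: represents_def)
  also have "\<dots> = (\<Sum>(c, p, Q)\<leftarrow>r. c * moment (simple_stat p Q) n)"
    by (induction r) (auto simp: sum.distrib moment_def sum_distrib_left)
  finally show ?thesis .
qed

lemma bell_form_moment:
  assumes "represents r f"
  shows "bell_form (rep_length r) (rep_degree r) {n. \<forall>(c, p, Q)\<in>set r. num_consec p \<le> n} (moment f)"
proof -
  have "bell_form (rep_length r) (rep_degree r) {n. \<forall>(c, p, Q)\<in>set r. num_consec p \<le> n}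
      (\<lambda>n. \<Sum>(c, p, Q)\<leftarrow>r. c * moment (simple_stat p Q) n)"
  proof (rule bell_form_rep)
    fix c p Q assume "(c, p, Q) \<in> set r"
    then show "pat_length p \<le> rep_length r \<and> pat_length p + mpoly_degree Q \<le> rep_degree r"
      unfolding rep_length_def rep_degree_def by (force intro!: Max_ge)
  qed (use assms in \<open>auto simp: represents_def\<close>)
  then show ?thesis by (rule bell_form_cong) (simp add: moment_represents[OF assms])
qed

theorem theorem2p4:
  fixes f :: statistic and r :: stat_rep and N k :: nat
  assumes "represents r f"
    and "stat_degree f = N"
    and "rep_length r = k"
  shows "\<exists>R I K q. shifted_bell_poly I K q R \<and>
           (\<forall>n\<ge>1. (\<forall>(c, p, Q)\<in>set r. num_consec p \<le> n) \<longrightarrow> moment f n = R n) \<and>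
           K \<le> int N \<and> - int k \<le> I \<and>
           (\<forall>j::nat. I \<le> int N - int j \<and> int N - int j \<le> K \<longrightarrow>
              degree (q (int N - int j)) \<le> (if j \<le> N then j else j - 1))"
proof -
  \<comment> \<open>\<open>r0\<close> attains the degree of \<open>f\<close>, whereas the lower
    shift bound must come from the given \<open>r\<close>.\<close>
  obtain r0 where r0: "represents r0 f" "rep_degree r0 = N"
  proof -
    have "\<exists>r. represents r f \<and> rep_degree r = stat_degree f"
      unfolding stat_degree_def by (rule LeastI_ex) (use assms(1) in blast)
    then show ?thesis using that assms(2) by blast
  qed
  obtain q where q: "bell_coeffs k (rep_degree r) q"
    "\<And>n. (\<forall>(c, p, Q)\<in>set r. num_consec p \<le> n) \<Longrightarrow> moment f n = bell_sum k (rep_degree r) q n"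
    using bell_form_moment[OF assms(1)] assms(3) unfolding bell_form_def by auto
  obtain q0 where q0: "bell_coeffs (rep_length r0) N q0"
    "\<And>n. (\<forall>(c, p, Q)\<in>set r0. num_consec p \<le> n) \<Longrightarrow> moment f n = bell_sum (rep_length r0) N q0 n"
    using bell_form_moment[OF r0(1)] r0(2) unfolding bell_form_def by auto
  define n0 where "n0 = Max (insert 0 ((\<lambda>(c, p, Q). num_consec p) ` (set r \<union> set r0)))"
  have n0: "num_consec p \<le> n0" if "(c, p, Q) \<in> set r \<union> set r0" for c p Q
    unfolding n0_def by (rule Max_ge) (use that in force)+
  \<comment> \<open>From \<open>n0\<close> on both families give the same moments, so by uniqueness
    they agree and \<open>q\<close> inherits the bounds of both.\<close>
  have "q = q0"
  proof (rule bell_coeffs_unique[OF q(1) q0(1), of n0])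
    fix n assume n: "n \<ge> n0"
    have "moment f n = bell_sum k (rep_degree r) q n"
      by (rule q(2)) (use n0 n in fastforce)
    moreover have "moment f n = bell_sum (rep_length r0) N q0 n"
      by (rule q0(2)) (use n0 n in fastforce)
    ultimately show "bell_sum k (rep_degree r) q n = bell_sum (rep_length r0) N q0 n" by simp
  qed
  then have qN: "bell_coeffs (rep_length r0) N q" using q0(1) by simp
  \<comment> \<open>The lower shift bound comes from \<open>r\<close>, the upper shift and degree
    bounds from \<open>r0\<close>.\<close>
  have kN: "bell_coeffs k N q"
    using q(1) qN unfolding bell_coeffs_def by blast
  have sum: "bell_sum k (rep_degree r) q n = bell_sum k N q n" for n
    using bell_sum_extend[OF q(1), of k "max N (rep_degree r)" n]
      bell_sum_extend[OF kN, of k "max N (rep_degree r)" n] by simp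
  show ?thesis
  proof (intro exI conjI allI impI)
    show "shifted_bell_poly (- int k) (int N) q (bell_sum k N q)"
      by (simp add: shifted_bell_poly_def bell_sum_def)
    show "moment f n = bell_sum k N q n" if "\<forall>(c, p, Q)\<in>set r. num_consec p \<le> n" for n
      using q(2)[OF that] sum by simp
    show "degree (q (int N - int j)) \<le> (if j \<le> N then j else j - 1)" for j
    proof (cases "q (int N - int j) = 0")
      case False
      then have "int (degree (q (int N - int j))) \<le> int j - (if int N - int j < 0 then 1 else 0)"
        using kN unfolding bell_coeffs_def by fastforce
      then show ?thesis by (auto split: if_splits)
    qed simp
  qed auto
qed

end
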